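(* Let $\lambda > 0$ and let $X = \{X_i\}_{i \ge 1}$ be a homogeneous Poisson point process with intensity $\lambda$ on $[0,\infty)$, with points indexed in increasing order. Suppose that $w \ge 1$. Let $E_0 := \{|G(X \cap [0,w])| = 0\}$ be the event that the Gilbert graph on $X \cap [0,w]$ has no edges, let $X^{(1)} := (X - X_1) \cap [1,\infty)$, and let $\mathcal F_1 := \sigma(X_1, X^{(1)})$. Then $$\mathbb P(E_0 \mid \mathcal F_1) = e^{-\lambda((w - X_1)_+ \wedge 1)}\, \mathbf 1\{G(X^{(1)} \cap [1, w - X_1]) = \emptyset\} \quad \text{almost surely}.$$
   Context: The points of $X$ are ordered so that $X_i \le X_j$ whenever $i \le j$; in particular $X_1$ is the left-most point. For a locally finite point set $\varphi \subset \mathbb R$, the Gilbert graph $G(\varphi)$ has the points of $\varphi$ as nodes, with an edge between two distinct points $x, y \in \varphi$ if $|x - y| \le 1$. The graph $G(\varphi)$ is identified with its edge set, so $|G(\varphi)|$ is the number of edges and $G(\varphi) = \emptyset$ means there are no edges. $X - X_1 := \{X_i - X_1 : i \ge 1\}$. $\sigma(X_1, X^{(1)})$ is the $\sigma$-algebra generated by the random variable $X_1$ and the point process $X^{(1)}$. Convention: $[a,b] = \emptyset$ if $a > b$. Notation: $x_+ = \max(x,0)$, $x \wedge y = \min(x,y)$, and $\mathbf 1\{\cdot\}$ is the indicator. *)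

theory Defs
  imports "HOL-Probability.Probability"
begin

definition locally_finite_set :: "real set \<Rightarrow> bool" where
  "locally_finite_set \<phi> \<longleftrightarrow> (\<forall>B. bounded B \<longrightarrow> finite (\<phi> \<inter> B))"

text \<open>The Gilbert graph on a point set, identified with its set of (undirected) edges.\<close>

definition gilbert :: "real set \<Rightarrow> real set set" where
  "gilbert \<phi> = {{x, y} | x y. x \<in> \<phi> \<and> y \<in> \<phi> \<and> x \<noteq> y \<and> \<bar>x - y\<bar> \<le> 1}"

text \<open>
  The space of locally finite point configurations, with the smallest \<open>\<sigma>\<close>-algebra that makes
  all the counts \<open>\<phi> \<mapsto> card (\<phi> \<inter> B)\<close>, for bounded Borel sets \<open>B\<close>, measurable.
  A point process is a measurable map into this space.
\<close>

definition config_space :: "real set measure" where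
  "config_space = sigma {\<phi>. locally_finite_set \<phi>}
     {{\<phi>. locally_finite_set \<phi> \<and> card (\<phi> \<inter> B) = k} | B k. B \<in> sets borel \<and> bounded B}"

text \<open>
  The Poisson probabilities are written out so that Lebesgue null sets \<open>B\<close> (mean \<open>0\<close>)
  are covered; the library's \<open>poisson_pmf\<close> assumes a positive rate.
\<close>

definition homogeneous_poisson_process ::
  "'a measure \<Rightarrow> real \<Rightarrow> real set \<Rightarrow> ('a \<Rightarrow> real set) \<Rightarrow> bool" where
  "homogeneous_poisson_process M rate S \<Phi> \<longleftrightarrow>
     \<Phi> \<in> M \<rightarrow>\<^sub>M config_space \<and>
     (\<forall>\<omega>\<in>space M. \<Phi> \<omega> \<subseteq> S) \<and>
     (\<forall>B k. B \<in> sets borel \<and> bounded B \<and> B \<subseteq> S \<longrightarrow>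
        measure M {\<omega> \<in> space M. card (\<Phi> \<omega> \<inter> B) = k} =
          exp (- (rate * measure lborel B)) * (rate * measure lborel B) ^ k / fact k) \<and>
     (\<forall>(n::nat) B. (\<forall>i<n. B i \<in> sets borel \<and> bounded (B i) \<and> B i \<subseteq> S) \<and>
        disjoint_family_on B {..<n} \<longrightarrow>
        prob_space.indep_vars M (\<lambda>_. count_space UNIV) (\<lambda>i \<omega>. card (\<Phi> \<omega> \<inter> B i)) {..<n})"

end

theory Submission imports Defs begin

text \<open>
  Write \<open>T\<close> for the left-most point. The window \<open>[0, w]\<close> carries no edge exactly when two things
  happen: no point lies in \<open>(T, max T (min (T + 1) w)]\<close>, so that \<open>T\<close> itself has no neighbour, and
  the points at distance at least \<open>1\<close> to the right of \<open>T\<close> have no edge among themselves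
  (\<open>gilbert_window_eq_empty_iff\<close>). The second event is a measurable function of \<open>T\<close> and of the
  shifted later points (\<open>sets_no_edge\<close>), hence lies in the conditioning \<open>\<sigma>\<close>-algebra. What remains is
  the conditional probability of the first event, and since \<open>T\<close> is a stopping time, the strong Markov
  property says that it is \<open>exp (- rate * length)\<close>, where the length is \<open>min (max (w - T) 0) 1\<close>.

  That instance of the strong Markov property is proved by discretisation. Approximate \<open>T\<close> strictly
  from above by a point \<open>u\<close> of a grid of mesh \<open>1 / (n + 1)\<close>. On the event that \<open>u\<close> is the
  approximating grid point, the configuration falls into three pieces on disjoint sets: the part before
  \<open>u\<close>, which decides that event, the gap inside \<open>(u, u + 1]\<close>, and the part beyond \<open>u + 1\<close>.
  Independent increments make the gap independent of the other two (\<open>prob_void_Int_counts\<close>,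
  \<open>prob_void_after_cell\<close>), and summing over the grid gives the identity for the approximation
  (\<open>void_after_grid\<close>). Counts over half-open intervals \<open>(a, b]\<close> are right-continuous in the pair
  of end points, so dominated convergence gives the identity at \<open>T\<close> (\<open>void_after_first\<close>).

  A monotone-class argument then passes from finitely many interval counts to all events in the
  conditioning \<open>\<sigma>\<close>-algebra (\<open>void_given_later\<close>). It uses that finitely many counts over half-open
  intervals generate the \<open>\<sigma>\<close>-algebra of configurations (\<open>sets_config_space\<close>), and that almost
  surely no point sits at \<open>T + 1\<close>, the closed end of the later part.
\<close>

section \<open>Configurations and interval counts\<close>

lemma space_config_space: "space config_space = {\<phi>. locally_finite_set \<phi>}"
  unfolding config_space_def by (rule space_measure_of) auto

lemma locally_finite_set_Int_bounded: "locally_finite_set \<phi> \<Longrightarrow> bounded B \<Longrightarrow> finite (\<phi> \<inter> B)"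
  by (simp add: locally_finite_set_def)

lemma measurable_card_config:
  assumes "B \<in> sets borel" "bounded B"
  shows "(\<lambda>\<phi>. card (\<phi> \<inter> B)) \<in> config_space \<rightarrow>\<^sub>M count_space UNIV"
proof (rule measurable_count_space_eq2_countable[THEN iffD2], intro conjI ballI)
  fix k :: nat
  have "{\<phi>. locally_finite_set \<phi> \<and> card (\<phi> \<inter> B) = k} \<in> sets config_space"
    unfolding config_space_def by (subst sets_measure_of) (use assms in auto)
  moreover have "(\<lambda>\<phi>. card (\<phi> \<inter> B)) -` {k} \<inter> space config_space
      = {\<phi>. locally_finite_set \<phi> \<and> card (\<phi> \<inter> B) = k}"
    by (auto simp: space_config_space)
  ultimately show "(\<lambda>\<phi>. card (\<phi> \<inter> B)) -` {k} \<inter> space config_space \<in> sets config_space"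
    by simp
qed auto

text \<open>
  Triples \<open>(a, b, k)\<close> form a set, and not a function of the interval, so that intersections of
  cylinders correspond to unions of their index sets.
\<close>
definition count_cylinder :: "(real \<times> real \<times> nat) set \<Rightarrow> real set set" where
  "count_cylinder J = {\<phi>. locally_finite_set \<phi> \<and> (\<forall>(a, b, k)\<in>J. card (\<phi> \<inter> {a<..b}) = k)}"

definition count_cylinders :: "real set set set" where
  "count_cylinders = count_cylinder ` {J. finite J}"

lemma Int_stable_count_cylinders: "Int_stable count_cylinders"
proof (rule Int_stableI)
  fix A B assume "A \<in> count_cylinders" "B \<in> count_cylinders"
  then obtain J K where "A = count_cylinder J" "B = count_cylinder K" "finite J" "finite K"
    by (auto simp: count_cylinders_def)
  moreover have "count_cylinder J \<inter> count_cylinder K = count_cylinder (J \<union> K)"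
    by (rule set_eqI) (simp add: count_cylinder_def ball_Un conj_ac)
  ultimately show "A \<inter> B \<in> count_cylinders"
    by (auto simp: count_cylinders_def)
qed

lemma card_interval_measurable_cylinders:
  "(\<lambda>\<phi>. card (\<phi> \<inter> {a<..b})) \<in> sigma {\<phi>. locally_finite_set \<phi>} count_cylinders \<rightarrow>\<^sub>M count_space UNIV"
proof (rule measurable_count_space_eq2_countable[THEN iffD2], intro conjI ballI)
  let ?S = "sigma {\<phi>. locally_finite_set \<phi>} count_cylinders"
  fix k :: nat
  have space: "space ?S = {\<phi>. locally_finite_set \<phi>}"
    by (rule space_measure_of) (auto simp: count_cylinders_def count_cylinder_def)
  have "count_cylinder {(a, b, k)} \<in> count_cylinders"
    by (auto simp: count_cylinders_def)
  then have "count_cylinder {(a, b, k)} \<in> sets ?S"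
    by (subst sets_measure_of) (auto simp: count_cylinders_def count_cylinder_def)
  moreover have "(\<lambda>\<phi>. card (\<phi> \<inter> {a<..b})) -` {k} \<inter> space ?S = count_cylinder {(a, b, k)}"
    by (auto simp: space count_cylinder_def)
  ultimately show "(\<lambda>\<phi>. card (\<phi> \<inter> {a<..b})) -` {k} \<inter> space ?S \<in> sets ?S"
    by simp
qed auto

text \<open>
  Dynkin's argument in the Borel set. The counting measure with values in \<open>ennreal\<close> replaces
  \<open>card\<close> because it is countably additive without side conditions; the bounded window keeps it finite,
  which the complement step needs for subtraction.
\<close>
lemma emeasure_count_measurable_cylinders:
  fixes c :: real
  assumes "B \<in> sets borel"
  shows "(\<lambda>\<phi>. emeasure (count_space UNIV) (\<phi> \<inter> B \<inter> {-c<..c}))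
           \<in> borel_measurable (sigma {\<phi>. locally_finite_set \<phi>} count_cylinders)"
    (is "?f B \<in> borel_measurable ?S")
proof -
  have space: "space ?S = {\<phi>. locally_finite_set \<phi>}"
    by (rule space_measure_of) (auto simp: count_cylinders_def count_cylinder_def)
  have fin: "finite (\<phi> \<inter> A \<inter> {-c<..c})" if "\<phi> \<in> space ?S" for \<phi> A
  proof -
    have "finite (\<phi> \<inter> {-c<..c})"
      using that unfolding space by (auto intro!: locally_finite_set_Int_bounded)
    then show ?thesis
      by (rule rev_finite_subset) auto
  qed
  have Ioc: "?f {a<..b} \<in> borel_measurable ?S" for a b
  proof -
    have "?f {a<..b} \<phi> = of_nat (card (\<phi> \<inter> {max a (-c)<..min b c}))" if "\<phi> \<in> space ?S" for \<phi>
    proof -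
      have "\<phi> \<inter> {a<..b} \<inter> {-c<..c} = \<phi> \<inter> {max a (-c)<..min b c}"
        by auto
      with fin[OF that, of "{a<..b}"] show ?thesis
        by (simp add: emeasure_count_space_finite)
    qed
    moreover have "(\<lambda>\<phi>. of_nat (card (\<phi> \<inter> {max a (-c)<..min b c})) :: ennreal) \<in> borel_measurable ?S"
      by (rule measurable_compose[OF card_interval_measurable_cylinders]) simp
    ultimately show ?thesis
      by (subst measurable_cong) auto
  qed
  have "Int_stable (range (\<lambda>(a, b). {a<..b::real}))"
  proof (rule Int_stableI)
    fix A B assume "A \<in> range (\<lambda>(a, b). {a<..b::real})" "B \<in> range (\<lambda>(a, b). {a<..b::real})"
    then obtain a b c d where "A = {a<..b}" "B = {c<..d}"
      by auto
    then show "A \<inter> B \<in> range (\<lambda>(a, b). {a<..b::real})"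
      by (auto intro: range_eqI[of _ _ "(max a c, min b d)"])
  qed
  moreover have "range (\<lambda>(a, b). {a<..b::real}) \<subseteq> Pow UNIV"
    by simp
  moreover have "B \<in> sigma_sets UNIV (range (\<lambda>(a, b). {a<..b::real}))"
    using assms by (simp add: borel_sigma_sets_Ioc)
  ultimately show ?thesis
  proof (induction rule: sigma_sets_induct_disjoint)
    case (basic A)
    then show ?case using Ioc by auto
  next
    case empty
    then show ?case by simp
  next
    case (compl A)
    have "?f (UNIV - A) \<phi> = ?f UNIV \<phi> - ?f A \<phi>" if "\<phi> \<in> space ?S" for \<phi>
    proof -
      have "\<phi> \<inter> (UNIV - A) \<inter> {-c<..c} = (\<phi> \<inter> UNIV \<inter> {-c<..c}) - (\<phi> \<inter> A \<inter> {-c<..c})"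
        by auto
      moreover have "emeasure (count_space UNIV) ((\<phi> \<inter> UNIV \<inter> {-c<..c}) - (\<phi> \<inter> A \<inter> {-c<..c}))
          = ?f UNIV \<phi> - ?f A \<phi>"
        by (rule emeasure_Diff) (use fin[OF that, of A] in \<open>auto simp: emeasure_count_space_finite\<close>)
      ultimately show ?thesis
        by simp
    qed
    moreover have "?f UNIV \<in> borel_measurable ?S"
    proof -
      have "?f UNIV \<phi> = ?f {-c<..c} \<phi>" for \<phi>
        by (simp add: Int_assoc)
      then show ?thesis
        using Ioc[of "-c" c] by simp
    qed
    ultimately show ?case
      using compl by (subst measurable_cong[where g="\<lambda>\<phi>. ?f UNIV \<phi> - ?f A \<phi>"]) auto
  next
    case (union A)
    have "?f (\<Union>i. A i) \<phi> = (\<Sum>i. ?f (A i) \<phi>)" for \<phi>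
    proof -
      have "\<phi> \<inter> (\<Union>i. A i) \<inter> {-c<..c} = (\<Union>i. \<phi> \<inter> A i \<inter> {-c<..c})"
        by auto
      moreover have "disjoint_family (\<lambda>i. \<phi> \<inter> A i \<inter> {-c<..c})"
        using union(1) by (auto simp: disjoint_family_on_def)
      ultimately show ?thesis
        by (subst suminf_emeasure) auto
    qed
    then show ?case
      using union by simp
  qed
qed

text \<open>
  Half-open intervals suffice to generate the \<open>\<sigma>\<close>-algebra. This matters because their counts
  are eventually constant when the end points converge from the right.
\<close>
lemma sets_config_space: "sets config_space = sigma_sets {\<phi>. locally_finite_set \<phi>} count_cylinders"
proof (rule antisym)
  let ?S = "sigma {\<phi>. locally_finite_set \<phi>} count_cylinders"
  have space: "space ?S = {\<phi>. locally_finite_set \<phi>}"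
    by (rule space_measure_of) (auto simp: count_cylinders_def count_cylinder_def)
  have sets: "sets ?S = sigma_sets {\<phi>. locally_finite_set \<phi>} count_cylinders"
    by (rule sets_measure_of) (auto simp: count_cylinders_def count_cylinder_def)
  have "{\<phi>. locally_finite_set \<phi> \<and> card (\<phi> \<inter> B) = k} \<in> sets ?S"
    if B: "B \<in> sets borel" "bounded B" for B k
  proof -
    obtain c where c: "\<And>x. x \<in> B \<Longrightarrow> \<bar>x\<bar> < c"
      using B(2) by (metis bounded_pos_less real_norm_def)
    have "B \<inter> {-c<..c} = B"
      using c by force
    then have "emeasure (count_space UNIV) (\<phi> \<inter> B \<inter> {-c<..c}) = of_nat (card (\<phi> \<inter> B))"
      if "locally_finite_set \<phi>" for \<phi>
      using locally_finite_set_Int_bounded[OF that B(2)]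
      by (simp add: Int_assoc emeasure_count_space_finite)
    then have "{\<phi>. locally_finite_set \<phi> \<and> card (\<phi> \<inter> B) = k}
        = {\<phi> \<in> space ?S. emeasure (count_space UNIV) (\<phi> \<inter> B \<inter> {-c<..c}) = of_nat k}"
      by (auto simp: space)
    also have "\<dots> \<in> sets ?S"
      using emeasure_count_measurable_cylinders[OF B(1), of c] by measurable
    finally show ?thesis .
  qed
  then show "sets config_space \<subseteq> sigma_sets {\<phi>. locally_finite_set \<phi>} count_cylinders"
    unfolding config_space_def sets[symmetric]
    by (subst sets_measure_of) (auto intro!: sets.sigma_sets_subset[of _ ?S, unfolded space])
  have "count_cylinder J \<in> sets config_space" if "finite J" for J
  proof -
    have "count_cylinder J = {\<phi> \<in> space config_space. \<forall>x\<in>J. card (\<phi> \<inter> {fst x<..fst (snd x)}) = snd (snd x)}"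
      by (auto simp: count_cylinder_def space_config_space)
    also have "\<dots> \<in> sets config_space"
    proof (cases "J = {}")
      case False
      show ?thesis
      proof (intro sets.sets_Collect_finite_All' that False)
        fix x assume "x \<in> J"
        have "(\<lambda>\<phi>. card (\<phi> \<inter> {fst x<..fst (snd x)})) \<in> config_space \<rightarrow>\<^sub>M count_space UNIV"
          by (rule measurable_card_config) auto
        then show "{\<phi> \<in> space config_space. card (\<phi> \<inter> {fst x<..fst (snd x)}) = snd (snd x)} \<in> sets config_space"
          by measurable
      qed
    qed simp
    finally show ?thesis .
  qed
  then show "sigma_sets {\<phi>. locally_finite_set \<phi>} count_cylinders \<subseteq> sets config_space"
    by (intro sets.sigma_sets_subset[of _ config_space, unfolded space_config_space])
       (auto simp: count_cylinders_def)
qed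

text \<open>
  Right-continuity of half-open interval counts: a point at the excluded left end stays excluded, one at
  the included right end stays included, and every other of the finitely many nearby points has positive
  distance from both ends.
\<close>
lemma eventually_Int_Ioc_eq:
  fixes l r :: real
  assumes "locally_finite_set \<phi>"
    and l: "ls \<longlonglongrightarrow> l" "\<And>n. l \<le> ls n" and r: "rs \<longlonglongrightarrow> r" "\<And>n. r \<le> rs n"
  shows "\<forall>\<^sub>F n in sequentially. \<phi> \<inter> {ls n<..rs n} = \<phi> \<inter> {l<..r}"
proof -
  have fin: "finite (\<phi> \<inter> {l<..r + 1})"
    using assms(1) by (rule locally_finite_set_Int_bounded) auto
  have "\<forall>\<^sub>F n in sequentially. \<forall>x\<in>\<phi> \<inter> {l<..r + 1}. x \<in> {ls n<..rs n} \<longleftrightarrow> x \<in> {l<..r}"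
  proof (rule eventually_ball_finite[OF fin], intro ballI)
    fix x assume x: "x \<in> \<phi> \<inter> {l<..r + 1}"
    show "\<forall>\<^sub>F n in sequentially. x \<in> {ls n<..rs n} \<longleftrightarrow> x \<in> {l<..r}"
    proof (cases "x \<le> r")
      case True
      have "\<forall>\<^sub>F n in sequentially. ls n < x"
        using l(1) x by (intro order_tendstoD) auto
      then show ?thesis
        by eventually_elim (use x True r(2) order_trans in fastforce)
    next
      case False
      then have "\<forall>\<^sub>F n in sequentially. rs n < x"
        using r(1) by (intro order_tendstoD) auto
      then show ?thesis
        by eventually_elim (use False in auto)
    qed
  qed
  moreover have "\<forall>\<^sub>F n in sequentially. rs n < r + 1"
    using r(1) by (intro order_tendstoD) auto
  ultimately show ?thesis
  proof eventually_elim
    case (elim n)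
    have "x \<in> {l<..r + 1}" if "x \<in> {ls n<..rs n} \<or> x \<in> {l<..r}" for x
      using that elim(2) l(2)[of n] by auto
    with elim(1) show ?case
      by blast
  qed
qed

section \<open>Independence of a gap from the counts outside it\<close>

lemma (in prob_space) indep_vars_reindex:
  assumes inj: "inj_on h I" and indep: "indep_vars N X (h ` I)"
  shows "indep_vars (N \<circ> h) (X \<circ> h) I"
  unfolding indep_vars_def2 indep_sets_def
proof (intro conjI ballI allI impI)
  fix i assume "i \<in> I"
  then show "random_variable ((N \<circ> h) i) ((X \<circ> h) i)"
    and "{(X \<circ> h) i -` A \<inter> space M |A. A \<in> sets ((N \<circ> h) i)} \<subseteq> events"
    using indep by (auto simp: indep_vars_def2)
next
  fix J A
  assume J: "J \<subseteq> I" "J \<noteq> {}" "finite J"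
    and A: "A \<in> (\<Pi> i\<in>J. {(X \<circ> h) i -` A \<inter> space M |A. A \<in> sets ((N \<circ> h) i)})"
  have inj: "inj_on h J"
    using inj J(1) by (rule inj_on_subset)
  have "prob (\<Inter>k\<in>h ` J. A (inv_into J h k)) = (\<Prod>k\<in>h ` J. prob (A (inv_into J h k)))"
    using J A inj indep unfolding indep_vars_def2
    by (intro indep_setsD[of "\<lambda>i. {X i -` A \<inter> space M |A. A \<in> sets (N i)}" "h ` I"]) auto
  then show "prob (\<Inter>j\<in>J. A j) = (\<Prod>j\<in>J. prob (A j))"
    using inj by (simp add: prod.reindex)
qed

text \<open>
  The enumeration of the process enters only through its first point, so the locale keeps just the
  property that characterises it: \<open>T\<close> is the least point of every configuration.
\<close>
locale first_poisson_point = prob_space +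
  fixes rate :: real and \<Phi> :: "'a \<Rightarrow> real set" and T :: "'a \<Rightarrow> real"
  assumes poisson: "homogeneous_poisson_process M rate {0..} \<Phi>"
    and rate_pos: "0 < rate"
    and first_in: "\<omega> \<in> space M \<Longrightarrow> T \<omega> \<in> \<Phi> \<omega>"
    and first_le: "\<omega> \<in> space M \<Longrightarrow> x \<in> \<Phi> \<omega> \<Longrightarrow> T \<omega> \<le> x"
begin

lemma measurable_process [measurable]: "\<Phi> \<in> M \<rightarrow>\<^sub>M config_space"
  using poisson by (simp add: homogeneous_poisson_process_def)

lemma process_nonneg: "\<omega> \<in> space M \<Longrightarrow> x \<in> \<Phi> \<omega> \<Longrightarrow> 0 \<le> x"
  using poisson by (auto simp: homogeneous_poisson_process_def)

lemma first_nonneg: "\<omega> \<in> space M \<Longrightarrow> 0 \<le> T \<omega>"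
  by (rule process_nonneg[OF _ first_in])

lemma locally_finite_process: "\<omega> \<in> space M \<Longrightarrow> locally_finite_set (\<Phi> \<omega>)"
  using measurable_space[OF measurable_process] by (simp add: space_config_space)

lemma measurable_count:
  "B \<in> sets borel \<Longrightarrow> bounded B \<Longrightarrow> (\<lambda>\<omega>. card (\<Phi> \<omega> \<inter> B)) \<in> M \<rightarrow>\<^sub>M count_space UNIV"
  by (rule measurable_compose[OF measurable_process measurable_card_config])

lemma measurable_count_Ioc [measurable]:
  "(\<lambda>\<omega>. card (\<Phi> \<omega> \<inter> {a<..b})) \<in> M \<rightarrow>\<^sub>M count_space UNIV"
  by (rule measurable_count) auto

lemma void_probability:
  assumes "0 \<le> a" "a \<le> b"
  shows "prob {\<omega> \<in> space M. card (\<Phi> \<omega> \<inter> {a<..b}) = 0} = exp (- rate * (b - a))"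
proof -
  have sub: "{a<..b} \<subseteq> {0..}"
    using assms by auto
  have "prob {\<omega> \<in> space M. card (\<Phi> \<omega> \<inter> {a<..b}) = 0} =
      exp (- (rate * measure lborel {a<..b})) * (rate * measure lborel {a<..b}) ^ 0 / fact 0"
    using poisson[unfolded homogeneous_poisson_process_def, THEN conjunct2, THEN conjunct2,
        THEN conjunct1, rule_format, of "{a<..b}" 0] sub
    by simp
  then show ?thesis
    using assms by simp
qed

lemma indep_vars_counts:
  assumes "finite I" and B: "\<And>i. i \<in> I \<Longrightarrow> B i \<in> sets borel" "\<And>i. i \<in> I \<Longrightarrow> bounded (B i)"
      "\<And>i. i \<in> I \<Longrightarrow> B i \<subseteq> {0..}"
    and disj: "disjoint_family_on B I"
  shows "indep_vars (\<lambda>_. count_space UNIV) (\<lambda>i \<omega>. card (\<Phi> \<omega> \<inter> B i)) I"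
proof -
  obtain h where h: "bij_betw h I {0..<card I}"
    using ex_bij_betw_finite_nat[OF \<open>finite I\<close>] by blast
  define g where "g = inv_into I h"
  have g: "g n \<in> I" if "n < card I" for n
    using h that unfolding g_def by (metis atLeastLessThan_iff bij_betw_imp_surj_on inv_into_into zero_le)
  have inj: "inj_on g {..<card I}"
    unfolding g_def using bij_betw_inv_into[OF h] by (auto simp: bij_betw_def lessThan_atLeast0)
  have gh: "g (h i) = i" if "i \<in> I" for i
    unfolding g_def using h that by (simp add: bij_betw_def inv_into_f_f)
  have "disjoint_family_on (\<lambda>n. B (g n)) {..<card I}"
    unfolding disjoint_family_on_def
  proof (intro ballI impI)
    fix m n assume mn: "m \<in> {..<card I}" "n \<in> {..<card I}" "m \<noteq> n"
    then have "g m \<noteq> g n"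
      using inj by (auto dest: inj_onD)
    then show "B (g m) \<inter> B (g n) = {}"
      using disj g mn by (auto simp: disjoint_family_on_def)
  qed
  then have "indep_vars (\<lambda>_. count_space UNIV) (\<lambda>n \<omega>. card (\<Phi> \<omega> \<inter> B (g n))) {..<card I}"
    using poisson[unfolded homogeneous_poisson_process_def, THEN conjunct2, THEN conjunct2,
        THEN conjunct2, rule_format, of "card I" "\<lambda>n. B (g n)"] g B
    by blast
  moreover have "h ` I = {..<card I}" "inj_on h I"
    using h by (auto simp: bij_betw_def)
  ultimately have "indep_vars ((\<lambda>_. count_space UNIV) \<circ> h) ((\<lambda>n \<omega>. card (\<Phi> \<omega> \<inter> B (g n))) \<circ> h) I"
    by (intro indep_vars_reindex) simp_all
  then show ?thesis
    by (rule indep_vars_cong[THEN iffD1, rotated -1]) (auto simp: gh)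
qed

text \<open>
  Independence is given for counts over disjoint sets, whereas the members of \<open>\<B>\<close> may overlap.
  Splitting their union into the atoms of the algebra generated by \<open>\<B>\<close> restores disjointness, and each
  count over \<open>B \<in> \<B>\<close> is the sum of the counts over the atoms inside \<open>B\<close>. As the counts are
  discrete, the predicate \<open>Q\<close> can be arbitrary.
\<close>
lemma prob_void_Int_counts:
  assumes "finite \<B>" and \<B>: "\<And>B. B \<in> \<B> \<Longrightarrow> B \<in> sets borel \<and> bounded B \<and> B \<subseteq> {0..}"
    and R: "R \<in> sets borel" "bounded R" "R \<subseteq> {0..}"
    and disj: "\<And>B. B \<in> \<B> \<Longrightarrow> B \<inter> R = {}"
  shows "prob {\<omega> \<in> space M. card (\<Phi> \<omega> \<inter> R) = 0 \<and> Q (\<lambda>B\<in>\<B>. card (\<Phi> \<omega> \<inter> B))} =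
    prob {\<omega> \<in> space M. card (\<Phi> \<omega> \<inter> R) = 0} * prob {\<omega> \<in> space M. Q (\<lambda>B\<in>\<B>. card (\<Phi> \<omega> \<inter> B))}"
proof -
  (* The atom indexed by J lies in exactly the members of J. The index {} would give the unbounded
     complement of all of them; it is free to carry R instead. *)
  define atom where "atom J = (if J = {} then R else {x. {B\<in>\<B>. x \<in> B} = J})" for J
  define I where "I = Pow \<B> - {{}}"
  have "finite I" "finite (Pow \<B>)"
    using \<open>finite \<B>\<close> by (auto simp: I_def)
  have sub: "atom J \<subseteq> B" if "B \<in> J" for B J
    using that by (auto simp: atom_def)
  have atom: "atom J \<in> sets borel \<and> bounded (atom J) \<and> atom J \<subseteq> {0..}" if "J \<in> Pow \<B>" for J
  proof (cases "J = {}")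
    case True
    then show ?thesis using R by (simp add: atom_def)
  next
    case False
    then obtain B where B: "B \<in> J" by blast
    with that have "B \<in> \<B>" by auto
    have "atom J = (\<Inter>B\<in>J. B) - (\<Union>B\<in>\<B> - J. B)"
      using False that by (auto simp: atom_def)
    moreover have "(\<Inter>B\<in>J. B) - (\<Union>B\<in>\<B> - J. B) \<in> sets borel"
      using False that \<B> \<open>finite \<B>\<close>
      by (intro sets.Diff sets.finite_INT sets.finite_UN) (auto intro: finite_subset)
    ultimately show ?thesis
      using \<B>[OF \<open>B \<in> \<B>\<close>] sub[OF B] by (auto intro: bounded_subset)
  qed
  have "disjoint_family_on atom (Pow \<B>)"
    using disj unfolding disjoint_family_on_def atom_def by (auto split: if_splits)
  then have "indep_vars (\<lambda>_. count_space UNIV) (\<lambda>J \<omega>. card (\<Phi> \<omega> \<inter> atom J)) (Pow \<B>)"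
    using atom \<open>finite (Pow \<B>)\<close> by (intro indep_vars_counts) auto
  then have "indep_var (PiM {{}} (\<lambda>_. count_space UNIV)) (\<lambda>\<omega>. \<lambda>J\<in>{{}}. card (\<Phi> \<omega> \<inter> atom J))
      (PiM I (\<lambda>_. count_space UNIV)) (\<lambda>\<omega>. \<lambda>J\<in>I. card (\<Phi> \<omega> \<inter> atom J))"
    by (rule indep_var_restrict) (auto simp: I_def)
  then have indep: "indep_var (count_space (PiE {{}} (\<lambda>_. UNIV))) (\<lambda>\<omega>. \<lambda>J\<in>{{}}. card (\<Phi> \<omega> \<inter> atom J))
      (count_space (PiE I (\<lambda>_. UNIV))) (\<lambda>\<omega>. \<lambda>J\<in>I. card (\<Phi> \<omega> \<inter> atom J))"
    using \<open>finite I\<close> by (simp add: count_space_PiM_finite del: PiE_UNIV_domain)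
  have count: "card (\<Phi> \<omega> \<inter> B) = (\<Sum>J\<in>{J\<in>I. B \<in> J}. card (\<Phi> \<omega> \<inter> atom J))"
    if "\<omega> \<in> space M" "B \<in> \<B>" for \<omega> B
  proof -
    have eq: "\<Phi> \<omega> \<inter> B = (\<Union>J\<in>{J\<in>I. B \<in> J}. \<Phi> \<omega> \<inter> atom J)"
    proof (intro antisym subsetI)
      fix x assume x: "x \<in> \<Phi> \<omega> \<inter> B"
      with that have "{B\<in>\<B>. x \<in> B} \<in> {J\<in>I. B \<in> J}" "x \<in> atom {B\<in>\<B>. x \<in> B}"
        by (auto simp: I_def atom_def)
      with x show "x \<in> (\<Union>J\<in>{J\<in>I. B \<in> J}. \<Phi> \<omega> \<inter> atom J)"
        by blast
    next
      fix x assume "x \<in> (\<Union>J\<in>{J\<in>I. B \<in> J}. \<Phi> \<omega> \<inter> atom J)"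
      then show "x \<in> \<Phi> \<omega> \<inter> B"
        using sub by blast
    qed
    have "finite (\<Phi> \<omega> \<inter> atom J)" if "J \<in> I" for J
      using that atom[of J] locally_finite_process[OF \<open>\<omega> \<in> space M\<close>]
      by (intro locally_finite_set_Int_bounded) (auto simp: I_def)
    moreover have "atom J \<inter> atom K = {}" if "J \<in> I" "K \<in> I" "J \<noteq> K" for J K
      using that by (auto simp: I_def atom_def)
    ultimately show ?thesis
      unfolding eq using \<open>finite I\<close> by (intro card_UN_disjoint) auto
  qed
  define S where "S f = (\<lambda>B\<in>\<B>. \<Sum>J\<in>{J\<in>I. B \<in> J}. f J)" for f :: "real set set \<Rightarrow> nat"
  have S: "S (\<lambda>J\<in>I. card (\<Phi> \<omega> \<inter> atom J)) = (\<lambda>B\<in>\<B>. card (\<Phi> \<omega> \<inter> B))" if "\<omega> \<in> space M" for \<omega>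
    unfolding S_def by (intro restrict_ext) (auto simp: count[OF that] intro!: sum.cong)
  define X where "X \<omega> = (\<lambda>J\<in>{{}}. card (\<Phi> \<omega> \<inter> atom J))" for \<omega>
  define Y where "Y \<omega> = (\<lambda>J\<in>I. card (\<Phi> \<omega> \<inter> atom J))" for \<omega>
  define A :: "(real set set \<Rightarrow> nat) set" where "A = {f \<in> PiE {{}} (\<lambda>_. UNIV). f {} = 0}"
  define C :: "(real set set \<Rightarrow> nat) set" where "C = {f \<in> PiE I (\<lambda>_. UNIV). Q (S f)}"
  have X: "X \<omega> \<in> A \<longleftrightarrow> card (\<Phi> \<omega> \<inter> R) = 0" for \<omega>
    unfolding A_def X_def by (simp add: atom_def)
  have Y: "Y \<omega> \<in> C \<longleftrightarrow> Q (\<lambda>B\<in>\<B>. card (\<Phi> \<omega> \<inter> B))" if "\<omega> \<in> space M" for \<omega>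
    unfolding C_def Y_def by (simp add: S[OF that])
  have prod: "prob ((\<lambda>\<omega>. (X \<omega>, Y \<omega>)) -` (A \<times> C) \<inter> space M) = prob (X -` A \<inter> space M) * prob (Y -` C \<inter> space M)"
    using indep unfolding X_def[symmetric] Y_def[symmetric]
    by (rule indep_varD) (simp_all add: A_def C_def subset_iff del: PiE_UNIV_domain)
  have XY_vimage: "(\<lambda>\<omega>. (X \<omega>, Y \<omega>)) -` (A \<times> C) \<inter> space M
      = {\<omega> \<in> space M. card (\<Phi> \<omega> \<inter> R) = 0 \<and> Q (\<lambda>B\<in>\<B>. card (\<Phi> \<omega> \<inter> B))}"
    using X Y by blast
  have X_vimage: "X -` A \<inter> space M = {\<omega> \<in> space M. card (\<Phi> \<omega> \<inter> R) = 0}"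
    using X by blast
  have Y_vimage: "Y -` C \<inter> space M = {\<omega> \<in> space M. Q (\<lambda>B\<in>\<B>. card (\<Phi> \<omega> \<inter> B))}"
    using Y by blast
  show ?thesis
    by (rule prod[unfolded XY_vimage X_vimage Y_vimage])
qed

end

section \<open>Discretisation of the first point\<close>

lemma nn_integral_countable_partition:
  fixes f :: "'a \<Rightarrow> ennreal" and K :: "'a \<Rightarrow> nat"
  assumes f[measurable]: "f \<in> borel_measurable M" and K[measurable]: "K \<in> M \<rightarrow>\<^sub>M count_space UNIV"
  shows "(\<integral>\<^sup>+x. f x \<partial>M) = (\<Sum>k. \<integral>\<^sup>+x. f x * indicator {x \<in> space M. K x = k} x \<partial>M)"
proof -
  have "(\<integral>\<^sup>+x. f x \<partial>M) = (\<integral>\<^sup>+x. (\<Sum>k. f x * indicator {x \<in> space M. K x = k} x) \<partial>M)"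
  proof (rule nn_integral_cong)
    fix x assume "x \<in> space M"
    then have "(\<Sum>k. f x * indicator {x \<in> space M. K x = k} x)
        = (\<Sum>k\<in>{K x}. f x * indicator {x \<in> space M. K x = k} x)"
      by (intro suminf_finite) auto
    then show "f x = (\<Sum>k. f x * indicator {x \<in> space M. K x = k} x)"
      using \<open>x \<in> space M\<close> by simp
  qed
  also have "\<dots> = (\<Sum>k. \<integral>\<^sup>+x. f x * indicator {x \<in> space M. K x = k} x \<partial>M)"
    by (rule nn_integral_suminf) measurable
  finally show ?thesis .
qed

text \<open>
  The next grid point strictly to the right. Strictness makes the event that \<open>u\<close> is the approximating
  grid point of \<open>T\<close> depend on the points in \<open>[0, u)\<close> only.
\<close>
definition grid_above :: "nat \<Rightarrow> real \<Rightarrow> real" where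
  "grid_above n t = (of_int \<lfloor>real (Suc n) * t\<rfloor> + 1) / real (Suc n)"

lemma grid_above_greater: "t < grid_above n t"
proof -
  have "real (Suc n) * t < of_int \<lfloor>real (Suc n) * t\<rfloor> + 1"
    by linarith
  then show ?thesis
    unfolding grid_above_def by (subst pos_less_divide_eq) (simp_all only: mult.commute of_nat_0_less_iff zero_less_Suc)
qed

lemma grid_above_le: "grid_above n t \<le> t + 1 / real (Suc n)"
proof -
  have "grid_above n t \<le> (real (Suc n) * t + 1) / real (Suc n)"
    unfolding grid_above_def by (intro divide_right_mono) auto
  also have "\<dots> = t + 1 / real (Suc n)"
    by (simp add: field_simps)
  finally show ?thesis .
qed

lemma grid_above_tendsto: "(\<lambda>n. grid_above n t) \<longlonglongrightarrow> t"
proof (rule tendsto_sandwich[where f = "\<lambda>_. t" and h = "\<lambda>n. t + 1 / real (Suc n)"])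
  show "(\<lambda>n. t + 1 / real (Suc n)) \<longlonglongrightarrow> t"
    using tendsto_add[OF tendsto_const LIMSEQ_Suc[OF lim_1_over_n], of t] by simp
qed (rule always_eventually allI less_imp_le[OF grid_above_greater] grid_above_le tendsto_const)+

definition counts_after :: "(real \<times> real \<times> nat) set \<Rightarrow> real \<Rightarrow> real set \<Rightarrow> bool" where
  "counts_after J t \<phi> \<longleftrightarrow> (\<forall>(a, b, k)\<in>J. card (\<phi> \<inter> {t + a<..t + b}) = k)"

context first_poisson_point
begin

text \<open>
  \<open>T\<close> is a stopping time: whether it lies before \<open>c\<close> is decided by the points before \<open>c\<close>.
\<close>
lemma first_less_iff:
  assumes "\<omega> \<in> space M"
  shows "T \<omega> < c \<longleftrightarrow> card (\<Phi> \<omega> \<inter> {0..<c}) \<noteq> 0"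
proof -
  have "finite (\<Phi> \<omega> \<inter> {0..<c})"
    using locally_finite_process[OF assms] by (rule locally_finite_set_Int_bounded) simp
  moreover have "T \<omega> < c \<longleftrightarrow> \<Phi> \<omega> \<inter> {0..<c} \<noteq> {}"
    using first_in[OF assms] first_le[OF assms] first_nonneg[OF assms] by fastforce
  ultimately show ?thesis
    by simp
qed

lemma measurable_first [measurable]: "T \<in> borel_measurable M"
  unfolding borel_measurable_iff_less
proof
  fix c
  have [measurable]: "(\<lambda>\<omega>. card (\<Phi> \<omega> \<inter> {0..<c})) \<in> M \<rightarrow>\<^sub>M count_space UNIV"
    by (rule measurable_count) auto
  have "{\<omega> \<in> space M. T \<omega> < c} = {\<omega> \<in> space M. card (\<Phi> \<omega> \<inter> {0..<c}) \<noteq> 0}"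
    using first_less_iff by blast
  also have "\<dots> \<in> sets M"
    by measurable
  finally show "{\<omega> \<in> space M. T \<omega> < c} \<in> sets M" .
qed

definition cell :: "nat \<Rightarrow> 'a \<Rightarrow> nat" where
  "cell n \<omega> = nat \<lfloor>real (Suc n) * T \<omega>\<rfloor>"

lemma measurable_cell [measurable]: "cell n \<in> M \<rightarrow>\<^sub>M count_space UNIV"
  unfolding cell_def by measurable

lemma grid_above_first:
  assumes "\<omega> \<in> space M"
  shows "grid_above n (T \<omega>) = (real (cell n \<omega>) + 1) / real (Suc n)"
proof -
  have "0 \<le> \<lfloor>real (Suc n) * T \<omega>\<rfloor>"
    using first_nonneg[OF assms] by simp
  then show ?thesis
    by (simp add: grid_above_def cell_def)
qed

lemma cell_eq_iff:
  assumes "\<omega> \<in> space M"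
  shows "cell n \<omega> = k \<longleftrightarrow> real k / real (Suc n) \<le> T \<omega> \<and> T \<omega> < (real k + 1) / real (Suc n)"
proof -
  have "0 \<le> \<lfloor>real (Suc n) * T \<omega>\<rfloor>"
    using first_nonneg[OF assms] by simp
  then have "cell n \<omega> = k \<longleftrightarrow> \<lfloor>real (Suc n) * T \<omega>\<rfloor> = int k"
    by (auto simp: cell_def)
  also have "\<dots> \<longleftrightarrow> real k \<le> real (Suc n) * T \<omega> \<and> real (Suc n) * T \<omega> < real k + 1"
    by (simp add: floor_eq_iff)
  also have "\<dots> \<longleftrightarrow> real k / real (Suc n) \<le> T \<omega> \<and> T \<omega> < (real k + 1) / real (Suc n)"
    by (simp add: pos_divide_le_eq pos_less_divide_eq mult.commute)
  finally show ?thesis .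
qed

text \<open>
  Counts over random intervals are measurable when the end points are functions of the grid
  approximation, which takes countably many values.
\<close>
lemma measurable_count_grid:
  "(\<lambda>\<omega>. card (\<Phi> \<omega> \<inter> {f (grid_above n (T \<omega>))<..g (grid_above n (T \<omega>))})) \<in> M \<rightarrow>\<^sub>M count_space UNIV"
proof -
  let ?u = "\<lambda>k. (real k + 1) / real (Suc n)"
  have "(\<lambda>\<omega>. card (\<Phi> \<omega> \<inter> {f (?u (cell n \<omega>))<..g (?u (cell n \<omega>))})) \<in> M \<rightarrow>\<^sub>M count_space UNIV"
    by (rule measurable_compose_countable[where g = "cell n"]) measurable
  then show ?thesis
    by (rule measurable_cong[THEN iffD2, rotated]) (simp only: grid_above_first)
qed

lemma eventually_count_grid:
  assumes "\<omega> \<in> space M" and "mono f" "mono g" "isCont f (T \<omega>)" "isCont g (T \<omega>)"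
  shows "\<forall>\<^sub>F n in sequentially.
    card (\<Phi> \<omega> \<inter> {f (grid_above n (T \<omega>))<..g (grid_above n (T \<omega>))}) = card (\<Phi> \<omega> \<inter> {f (T \<omega>)<..g (T \<omega>)})"
proof -
  have "\<forall>\<^sub>F n in sequentially.
      \<Phi> \<omega> \<inter> {f (grid_above n (T \<omega>))<..g (grid_above n (T \<omega>))} = \<Phi> \<omega> \<inter> {f (T \<omega>)<..g (T \<omega>)}"
    using assms
    by (intro eventually_Int_Ioc_eq locally_finite_process isCont_tendsto_compose[OF _ grid_above_tendsto])
       (auto elim!: monoD intro: less_imp_le grid_above_greater)
  then show ?thesis
    by eventually_elim simp
qed

text \<open>
  The limit of the discretised counts; monotonicity of the end points turns approximation of \<open>T\<close> from
  the right into approximation of both end points from the right.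
\<close>
lemma measurable_count_first:
  assumes "mono f" "mono g" "\<And>t. isCont f t" "\<And>t. isCont g t"
  shows "(\<lambda>\<omega>. card (\<Phi> \<omega> \<inter> {f (T \<omega>)<..g (T \<omega>)})) \<in> M \<rightarrow>\<^sub>M count_space UNIV"
proof -
  have [measurable]: "(\<lambda>\<omega>. real (card (\<Phi> \<omega> \<inter> {f (T \<omega>)<..g (T \<omega>)}))) \<in> borel_measurable M"
  proof (rule borel_measurable_LIMSEQ_real)
    fix \<omega> assume "\<omega> \<in> space M"
    show "(\<lambda>n. real (card (\<Phi> \<omega> \<inter> {f (grid_above n (T \<omega>))<..g (grid_above n (T \<omega>))})))
        \<longlonglongrightarrow> real (card (\<Phi> \<omega> \<inter> {f (T \<omega>)<..g (T \<omega>)}))"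
      using eventually_count_grid[OF \<open>\<omega> \<in> space M\<close> assms(1,2) assms(3,4)]
      by (intro tendsto_eventually) (auto elim: eventually_mono)
  next
    fix n
    show "(\<lambda>\<omega>. real (card (\<Phi> \<omega> \<inter> {f (grid_above n (T \<omega>))<..g (grid_above n (T \<omega>))}))) \<in> borel_measurable M"
      by (rule measurable_compose[OF measurable_count_grid]) simp
  qed
  show ?thesis
  proof (rule measurable_count_space_eq2_countable[THEN iffD2], intro conjI ballI)
    fix k :: nat
    have "(\<lambda>\<omega>. card (\<Phi> \<omega> \<inter> {f (T \<omega>)<..g (T \<omega>)})) -` {k} \<inter> space M
        = {\<omega> \<in> space M. real (card (\<Phi> \<omega> \<inter> {f (T \<omega>)<..g (T \<omega>)})) = real k}"
      by auto
    also have "\<dots> \<in> sets M"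
      by measurable
    finally show "(\<lambda>\<omega>. card (\<Phi> \<omega> \<inter> {f (T \<omega>)<..g (T \<omega>)})) -` {k} \<inter> space M \<in> sets M" .
  qed auto
qed

text \<open>
  The three sets involved are disjoint: \<open>[0, u)\<close> decides where \<open>T\<close> lies, the gap \<open>(p, q]\<close> is
  contained in \<open>(u, u + 1]\<close>, and \<open>counts_after J u\<close> looks only beyond \<open>u + 1\<close>.
\<close>
lemma prob_void_after_cell:
  assumes c_le: "c \<le> u" and u: "0 \<le> u" "u \<le> p" "p \<le> q" "q \<le> u + 1"
    and J: "finite J" "\<And>a b k. (a, b, k) \<in> J \<Longrightarrow> 1 \<le> a"
  shows "prob {\<omega> \<in> space M. (c \<le> T \<omega> \<and> T \<omega> < u) \<and> card (\<Phi> \<omega> \<inter> {p<..q}) = 0 \<and> counts_after J u (\<Phi> \<omega>)}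
    = exp (- rate * (q - p)) * prob {\<omega> \<in> space M. (c \<le> T \<omega> \<and> T \<omega> < u) \<and> counts_after J u (\<Phi> \<omega>)}"
proof -
  define \<B> where "\<B> = {{0..<c}, {0..<u}} \<union> (\<lambda>(a, b, k). {u + a<..u + b}) ` J"
  (* c <= T < u says that [0, c) is empty and [0, u) is not. *)
  define Q where "Q f \<longleftrightarrow> f {0..<c} = 0 \<and> f {0..<u} \<noteq> 0 \<and> (\<forall>(a, b, k)\<in>J. f {u + a<..u + b} = k)"
    for f :: "real set \<Rightarrow> nat"
  have mem: "{0..<c} \<in> \<B>" "{0..<u} \<in> \<B>" and memJ: "\<And>a b k. (a, b, k) \<in> J \<Longrightarrow> {u + a<..u + b} \<in> \<B>"
    by (force simp: \<B>_def)+
  have Q: "Q (\<lambda>B\<in>\<B>. card (\<Phi> \<omega> \<inter> B)) \<longleftrightarrow> (c \<le> T \<omega> \<and> T \<omega> < u) \<and> counts_after J u (\<Phi> \<omega>)"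
    if "\<omega> \<in> space M" for \<omega>
  proof -
    have "(\<forall>(a, b, k)\<in>J. (\<lambda>B\<in>\<B>. card (\<Phi> \<omega> \<inter> B)) {u + a<..u + b} = k) \<longleftrightarrow> counts_after J u (\<Phi> \<omega>)"
      unfolding counts_after_def by (rule ball_cong) (auto simp: memJ)
    then show ?thesis
      using mem by (simp add: Q_def first_less_iff[OF that] not_less[symmetric])
  qed
  have prod: "prob {\<omega> \<in> space M. card (\<Phi> \<omega> \<inter> {p<..q}) = 0 \<and> Q (\<lambda>B\<in>\<B>. card (\<Phi> \<omega> \<inter> B))}
      = prob {\<omega> \<in> space M. card (\<Phi> \<omega> \<inter> {p<..q}) = 0} * prob {\<omega> \<in> space M. Q (\<lambda>B\<in>\<B>. card (\<Phi> \<omega> \<inter> B))}"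
  proof (rule prob_void_Int_counts)
    show "finite \<B>"
      using J(1) by (simp add: \<B>_def)
    show "{p<..q} \<in> sets borel" "bounded {p<..q}" "{p<..q} \<subseteq> {0..}"
      using u by auto
    fix B assume "B \<in> \<B>"
    then consider "B = {0..<c}" | "B = {0..<u}" | a b k where "(a, b, k) \<in> J" "B = {u + a<..u + b}"
      by (auto simp: \<B>_def)
    then have "B \<in> sets borel \<and> bounded B \<and> B \<subseteq> {0..} \<and> B \<inter> {p<..q} = {}"
    proof cases
      case 1
      then show ?thesis
        using u c_le by auto
    next
      case 2
      then show ?thesis
        using u by auto
    next
      case (3 a b k)
      then have "1 \<le> a"
        using J(2) by blast
      with 3 u show ?thesis
        by auto
    qed
    then show "B \<in> sets borel \<and> bounded B \<and> B \<subseteq> {0..}" "B \<inter> {p<..q} = {}"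
      by auto
  qed
  have both: "{\<omega> \<in> space M. card (\<Phi> \<omega> \<inter> {p<..q}) = 0 \<and> Q (\<lambda>B\<in>\<B>. card (\<Phi> \<omega> \<inter> B))}
      = {\<omega> \<in> space M. (c \<le> T \<omega> \<and> T \<omega> < u) \<and> card (\<Phi> \<omega> \<inter> {p<..q}) = 0 \<and> counts_after J u (\<Phi> \<omega>)}"
    using Q by blast
  have after: "{\<omega> \<in> space M. Q (\<lambda>B\<in>\<B>. card (\<Phi> \<omega> \<inter> B))}
      = {\<omega> \<in> space M. (c \<le> T \<omega> \<and> T \<omega> < u) \<and> counts_after J u (\<Phi> \<omega>)}"
    using Q by blast
  have void: "prob {\<omega> \<in> space M. card (\<Phi> \<omega> \<inter> {p<..q}) = 0} = exp (- rate * (q - p))"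
    using u by (intro void_probability) auto
  show ?thesis
    by (rule prod[unfolded both after void])
qed

end

context first_poisson_point
begin

section \<open>The gap after the first point\<close>

lemma measurable_counts_after_grid [measurable]:
  assumes "finite J"
  shows "Measurable.pred M (\<lambda>\<omega>. counts_after J (grid_above n (T \<omega>)) (\<Phi> \<omega>))"
  unfolding counts_after_def case_prod_beta
proof (rule pred_intros_finite(3)[OF assms])
  fix x :: "real \<times> real \<times> nat"
  have "(\<lambda>\<omega>. card (\<Phi> \<omega> \<inter> {grid_above n (T \<omega>) + fst x<..grid_above n (T \<omega>) + fst (snd x)}))
      \<in> M \<rightarrow>\<^sub>M count_space UNIV"
    by (rule measurable_count_grid)
  then show "Measurable.pred M (\<lambda>\<omega>. card (\<Phi> \<omega> \<inter> {grid_above n (T \<omega>) + fst x<..grid_above n (T \<omega>) + fst (snd x)})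
      = snd (snd x))"
    by measurable
qed

lemma measurable_counts_after_first [measurable]:
  assumes "finite J"
  shows "Measurable.pred M (\<lambda>\<omega>. counts_after J (T \<omega>) (\<Phi> \<omega>))"
  unfolding counts_after_def case_prod_beta
proof (rule pred_intros_finite(3)[OF assms])
  fix x :: "real \<times> real \<times> nat"
  have "(\<lambda>\<omega>. card (\<Phi> \<omega> \<inter> {T \<omega> + fst x<..T \<omega> + fst (snd x)})) \<in> M \<rightarrow>\<^sub>M count_space UNIV"
    by (rule measurable_count_first) (auto intro!: monoI)
  then show "Measurable.pred M (\<lambda>\<omega>. card (\<Phi> \<omega> \<inter> {T \<omega> + fst x<..T \<omega> + fst (snd x)}) = snd (snd x))"
    by measurable
qed

lemma measurable_counts_after_const:
  assumes "finite J"
  shows "Measurable.pred M (\<lambda>\<omega>. counts_after J t (\<Phi> \<omega>))"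
  unfolding counts_after_def case_prod_beta
  by (rule pred_intros_finite(3)[OF assms]) measurable

lemma eventually_counts_after_grid:
  assumes "\<omega> \<in> space M" "finite J"
  shows "\<forall>\<^sub>F n in sequentially.
    counts_after J (grid_above n (T \<omega>)) (\<Phi> \<omega>) \<longleftrightarrow> counts_after J (T \<omega>) (\<Phi> \<omega>)"
proof -
  have "\<forall>\<^sub>F n in sequentially. \<forall>x\<in>J.
      card (\<Phi> \<omega> \<inter> {grid_above n (T \<omega>) + fst x<..grid_above n (T \<omega>) + fst (snd x)})
        = card (\<Phi> \<omega> \<inter> {T \<omega> + fst x<..T \<omega> + fst (snd x)})"
    by (rule eventually_ball_finite[OF assms(2)], intro ballI eventually_count_grid[OF assms(1)])
      (auto intro!: monoI)
  then show ?thesis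
    by eventually_elim (simp add: counts_after_def case_prod_beta)
qed

text \<open>
  On each event that \<open>T\<close> falls into the \<open>k\<close>-th grid cell, all random end points become constants, so
  \<open>prob_void_after_cell\<close> applies there; the cells partition the sample space.
\<close>
lemma void_after_grid:
  assumes mono: "mono l" "mono e"
    and bounds: "\<And>t. 0 \<le> t \<Longrightarrow> t \<le> l t \<and> l t \<le> e t \<and> e t \<le> t + 1"
    and J: "finite J" "\<And>a b k. (a, b, k) \<in> J \<Longrightarrow> 1 \<le> a"
  defines "G n \<equiv> \<lambda>\<omega>. grid_above n (T \<omega>)"
  shows "(\<integral>\<^sup>+\<omega>. ennreal (of_bool (t0 < G n \<omega> \<and> card (\<Phi> \<omega> \<inter> {l (G n \<omega>)<..e (G n \<omega>)}) = 0 \<and>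
              counts_after J (G n \<omega>) (\<Phi> \<omega>))) \<partial>M)
       = (\<integral>\<^sup>+\<omega>. ennreal (exp (- rate * (e (G n \<omega>) - l (G n \<omega>))) *
              of_bool (t0 < G n \<omega> \<and> counts_after J (G n \<omega>) (\<Phi> \<omega>))) \<partial>M)"
    (is "(\<integral>\<^sup>+\<omega>. ?f \<omega> \<partial>M) = (\<integral>\<^sup>+\<omega>. ?g \<omega> \<partial>M)")
proof -
  note [measurable] = J(1)
  have le[measurable]: "l \<in> borel_measurable borel" "e \<in> borel_measurable borel"
    using mono by (auto intro: borel_measurable_mono)
  have G[measurable]: "G n \<in> borel_measurable M"
    unfolding G_def grid_above_def by measurable
  have [measurable]: "(\<lambda>\<omega>. card (\<Phi> \<omega> \<inter> {l (G n \<omega>)<..e (G n \<omega>)})) \<in> M \<rightarrow>\<^sub>M count_space UNIV"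
    unfolding G_def by (rule measurable_count_grid)
  have [measurable]: "Measurable.pred M (\<lambda>\<omega>. counts_after J (G n \<omega>) (\<Phi> \<omega>))"
    unfolding G_def using J(1) by measurable
  have "(\<integral>\<^sup>+\<omega>. ?f \<omega> * indicator {\<omega> \<in> space M. cell n \<omega> = k} \<omega> \<partial>M)
      = (\<integral>\<^sup>+\<omega>. ?g \<omega> * indicator {\<omega> \<in> space M. cell n \<omega> = k} \<omega> \<partial>M)" for k
  proof -
    define u where "u = (real k + 1) / real (Suc n)"
    define c where "c = real k / real (Suc n)"
    let ?A = "{\<omega> \<in> space M. (c \<le> T \<omega> \<and> T \<omega> < u) \<and> card (\<Phi> \<omega> \<inter> {l u<..e u}) = 0 \<and> counts_after J u (\<Phi> \<omega>)}"
    let ?B = "{\<omega> \<in> space M. (c \<le> T \<omega> \<and> T \<omega> < u) \<and> counts_after J u (\<Phi> \<omega>)}"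
    note measurable_counts_after_const[OF J(1), measurable]
    have sets: "?A \<in> sets M" "?B \<in> sets M"
      by measurable
    have u: "c \<le> u" "0 \<le> u"
      by (auto simp: c_def u_def divide_right_mono)
    have cell: "cell n \<omega> = k \<longleftrightarrow> c \<le> T \<omega> \<and> T \<omega> < u" if "\<omega> \<in> space M" for \<omega>
      using cell_eq_iff[OF that] by (simp add: c_def u_def)
    have Gu: "G n \<omega> = u" if "\<omega> \<in> space M" "cell n \<omega> = k" for \<omega>
      unfolding G_def grid_above_first[OF that(1)] that(2) u_def by simp
    have "(\<integral>\<^sup>+\<omega>. ?f \<omega> * indicator {\<omega> \<in> space M. cell n \<omega> = k} \<omega> \<partial>M)
        = (\<integral>\<^sup>+\<omega>. ennreal (of_bool (t0 < u)) * indicator ?A \<omega> \<partial>M)"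
      by (rule nn_integral_cong) (auto simp: indicator_def Gu cell)
    also have "\<dots> = ennreal (of_bool (t0 < u)) * ennreal (prob ?A)"
      using sets by (simp add: nn_integral_cmult_indicator emeasure_eq_measure)
    also have "prob ?A = exp (- rate * (e u - l u)) * prob ?B"
      using u bounds[OF u(2)] J by (intro prob_void_after_cell) auto
    also have "ennreal (of_bool (t0 < u)) * ennreal (exp (- rate * (e u - l u)) * prob ?B)
        = (\<integral>\<^sup>+\<omega>. ennreal (of_bool (t0 < u) * exp (- rate * (e u - l u))) * indicator ?B \<omega> \<partial>M)"
      using sets by (simp add: nn_integral_cmult_indicator emeasure_eq_measure ennreal_mult mult.assoc)
    also have "\<dots> = (\<integral>\<^sup>+\<omega>. ?g \<omega> * indicator {\<omega> \<in> space M. cell n \<omega> = k} \<omega> \<partial>M)"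
      by (rule nn_integral_cong) (auto simp: indicator_def Gu cell)
    finally show ?thesis .
  qed
  then show ?thesis
    by (subst (1 2) nn_integral_countable_partition[where K = "cell n"]) simp_all
qed

text \<open>
  The strong Markov property at \<open>T\<close> in the form needed here: given \<open>T\<close>, the gap \<open>(l T, e T]\<close> is
  empty with probability \<open>exp (- rate * (e T - l T))\<close>, independently of finitely many counts at distance at least
  \<open>1\<close> from \<open>T\<close>. The threshold \<open>t0 \<le> T\<close> is closed since it is the limit of \<open>t0 < G n\<close>: the
  approximations \<open>G n\<close> lie strictly above \<open>T\<close>.
\<close>
proposition void_after_first:
  assumes mono: "mono l" "mono e" and cont: "\<And>t. isCont l t" "\<And>t. isCont e t"
    and bounds: "\<And>t. 0 \<le> t \<Longrightarrow> t \<le> l t \<and> l t \<le> e t \<and> e t \<le> t + 1"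
    and J: "finite J" "\<And>a b k. (a, b, k) \<in> J \<Longrightarrow> 1 \<le> a"
  shows "(\<integral>\<^sup>+\<omega>. ennreal (of_bool (t0 \<le> T \<omega> \<and> card (\<Phi> \<omega> \<inter> {l (T \<omega>)<..e (T \<omega>)}) = 0 \<and>
              counts_after J (T \<omega>) (\<Phi> \<omega>))) \<partial>M)
       = (\<integral>\<^sup>+\<omega>. ennreal (exp (- rate * (e (T \<omega>) - l (T \<omega>))) *
              of_bool (t0 \<le> T \<omega> \<and> counts_after J (T \<omega>) (\<Phi> \<omega>))) \<partial>M)"
    (is "(\<integral>\<^sup>+\<omega>. ?f \<omega> \<partial>M) = (\<integral>\<^sup>+\<omega>. ?g \<omega> \<partial>M)")
proof -
  define G where "G n \<omega> = grid_above n (T \<omega>)" for n \<omega>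
  let ?fn = "\<lambda>n \<omega>. ennreal (of_bool (t0 < G n \<omega> \<and> card (\<Phi> \<omega> \<inter> {l (G n \<omega>)<..e (G n \<omega>)}) = 0 \<and>
              counts_after J (G n \<omega>) (\<Phi> \<omega>)))"
  let ?gn = "\<lambda>n \<omega>. ennreal (exp (- rate * (e (G n \<omega>) - l (G n \<omega>))) *
              of_bool (t0 < G n \<omega> \<and> counts_after J (G n \<omega>) (\<Phi> \<omega>)))"
  have le[measurable]: "l \<in> borel_measurable borel" "e \<in> borel_measurable borel"
    using mono by (auto intro: borel_measurable_mono)
  have [measurable]: "G n \<in> borel_measurable M" for n
    unfolding G_def grid_above_def by measurable
  have [measurable]: "(\<lambda>\<omega>. card (\<Phi> \<omega> \<inter> {l (G n \<omega>)<..e (G n \<omega>)})) \<in> M \<rightarrow>\<^sub>M count_space UNIV" for n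
    unfolding G_def by (rule measurable_count_grid)
  have [measurable]: "(\<lambda>\<omega>. card (\<Phi> \<omega> \<inter> {l (T \<omega>)<..e (T \<omega>)})) \<in> M \<rightarrow>\<^sub>M count_space UNIV"
    by (rule measurable_count_first[OF mono cont])
  have [measurable]: "Measurable.pred M (\<lambda>\<omega>. counts_after J (G n \<omega>) (\<Phi> \<omega>))" for n
    unfolding G_def using J(1) by measurable
  have [measurable]: "Measurable.pred M (\<lambda>\<omega>. counts_after J (T \<omega>) (\<Phi> \<omega>))"
    using J(1) by measurable
  have G_nonneg: "0 \<le> G n \<omega>" if "\<omega> \<in> space M" for n \<omega>
    using first_nonneg[OF that] grid_above_greater[of "T \<omega>" n] by (simp add: G_def)
  have lim_G: "(\<lambda>n. G n \<omega>) \<longlonglongrightarrow> T \<omega>" for \<omega>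
    unfolding G_def by (rule grid_above_tendsto)
  have ev_threshold: "\<forall>\<^sub>F n in sequentially. t0 < G n \<omega> \<longleftrightarrow> t0 \<le> T \<omega>" for \<omega>
  proof (cases "t0 \<le> T \<omega>")
    case True
    have "t0 < G n \<omega>" for n
      using True grid_above_greater[of "T \<omega>" n] by (simp add: G_def)
    then show ?thesis
      using True by simp
  next
    case False
    then have "\<forall>\<^sub>F n in sequentially. G n \<omega> < t0"
      using lim_G by (intro order_tendstoD) auto
    then show ?thesis
      by eventually_elim (use False in auto)
  qed
  note ev = ev_threshold eventually_count_grid[OF _ mono cont, folded G_def]
    eventually_counts_after_grid[OF _ J(1), folded G_def]
  have "(\<lambda>n. \<integral>\<^sup>+\<omega>. ?fn n \<omega> \<partial>M) \<longlonglongrightarrow> (\<integral>\<^sup>+\<omega>. ?f \<omega> \<partial>M)"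
  proof (rule nn_integral_dominated_convergence[where w = "\<lambda>_. 1"])
    show "AE \<omega> in M. (\<lambda>n. ?fn n \<omega>) \<longlonglongrightarrow> ?f \<omega>"
    proof (rule AE_I2)
      fix \<omega> assume "\<omega> \<in> space M"
      have "\<forall>\<^sub>F n in sequentially. ?fn n \<omega> = ?f \<omega>"
        using ev(1)[of \<omega>] ev(2,3)[OF \<open>\<omega> \<in> space M\<close>] by eventually_elim simp
      then show "(\<lambda>n. ?fn n \<omega>) \<longlonglongrightarrow> ?f \<omega>"
        by (rule tendsto_eventually)
    qed
  qed (auto simp: of_bool_def emeasure_space_1)
  moreover have "(\<lambda>n. \<integral>\<^sup>+\<omega>. ?gn n \<omega> \<partial>M) \<longlonglongrightarrow> (\<integral>\<^sup>+\<omega>. ?g \<omega> \<partial>M)"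
  proof (rule nn_integral_dominated_convergence[where w = "\<lambda>_. 1"])
    show "AE \<omega> in M. (\<lambda>n. ?gn n \<omega>) \<longlonglongrightarrow> ?g \<omega>"
    proof (rule AE_I2)
      fix \<omega> assume "\<omega> \<in> space M"
      have "\<forall>\<^sub>F n in sequentially.
          of_bool (t0 < G n \<omega> \<and> counts_after J (G n \<omega>) (\<Phi> \<omega>))
            = (of_bool (t0 \<le> T \<omega> \<and> counts_after J (T \<omega>) (\<Phi> \<omega>)) :: real)"
        using ev(1)[of \<omega>] ev(3)[OF \<open>\<omega> \<in> space M\<close>] by eventually_elim simp
      then have "(\<lambda>n. of_bool (t0 < G n \<omega> \<and> counts_after J (G n \<omega>) (\<Phi> \<omega>)))
          \<longlonglongrightarrow> (of_bool (t0 \<le> T \<omega> \<and> counts_after J (T \<omega>) (\<Phi> \<omega>)) :: real)"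
        by (rule tendsto_eventually)
      moreover have "(\<lambda>n. exp (- rate * (e (G n \<omega>) - l (G n \<omega>))))
          \<longlonglongrightarrow> exp (- rate * (e (T \<omega>) - l (T \<omega>)))"
        by (intro tendsto_exp tendsto_mult tendsto_const tendsto_diff
            isCont_tendsto_compose[OF cont(1) lim_G] isCont_tendsto_compose[OF cont(2) lim_G])
      ultimately show "(\<lambda>n. ?gn n \<omega>) \<longlonglongrightarrow> ?g \<omega>"
        by (intro tendsto_ennrealI tendsto_mult)
    qed
    fix n
    show "AE \<omega> in M. ?gn n \<omega> \<le> 1"
    proof (rule AE_I2)
      fix \<omega> assume "\<omega> \<in> space M"
      then have "exp (- rate * (e (G n \<omega>) - l (G n \<omega>))) \<le> 1"
        using bounds[OF G_nonneg] rate_pos by (simp add: mult_nonneg_nonneg)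
      then show "?gn n \<omega> \<le> 1"
        by (simp add: of_bool_def)
    qed
  qed (auto simp: emeasure_space_1)
  moreover have "(\<integral>\<^sup>+\<omega>. ?fn n \<omega> \<partial>M) = (\<integral>\<^sup>+\<omega>. ?gn n \<omega> \<partial>M)" for n
    unfolding G_def by (rule void_after_grid[OF mono bounds J])
  ultimately show ?thesis
    using LIMSEQ_unique by simp
qed

end

section \<open>Measurability of having no edge\<close>

lemma gilbert_eq_empty_iff: "gilbert \<phi> = {} \<longleftrightarrow> (\<forall>x\<in>\<phi>. \<forall>y\<in>\<phi>. x < y \<longrightarrow> x + 1 < y)"
proof
  assume *: "gilbert \<phi> = {}"
  show "\<forall>x\<in>\<phi>. \<forall>y\<in>\<phi>. x < y \<longrightarrow> x + 1 < y"
  proof (intro ballI impI, rule ccontr)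
    fix x y assume "x \<in> \<phi>" "y \<in> \<phi>" "x < y" "\<not> x + 1 < y"
    then have "{x, y} \<in> gilbert \<phi>"
      unfolding gilbert_def by (intro CollectI exI[of _ x] exI[of _ y]) auto
    with * show False
      by simp
  qed
next
  assume *: "\<forall>x\<in>\<phi>. \<forall>y\<in>\<phi>. x < y \<longrightarrow> x + 1 < y"
  have "1 < \<bar>x - y\<bar>" if "x \<in> \<phi>" "y \<in> \<phi>" "x \<noteq> y" for x y
    using *[rule_format, of x y] *[rule_format, of y x] that by linarith
  then show "gilbert \<phi> = {}"
    unfolding gilbert_def by fastforce
qed

lemma finite_gilbert: "finite \<phi> \<Longrightarrow> finite (gilbert \<phi>)"
  by (rule finite_subset[of _ "Pow \<phi>"]) (auto simp: gilbert_def)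

text \<open>
  Rational windows slightly longer than \<open>1\<close> detect an edge. If for every tolerance some window holds
  two points, local finiteness leaves only finitely many candidate pairs, and one that works for
  arbitrarily small tolerances is an edge. The rational \<open>p\<close> approximates \<open>t\<close> in the same way, so that
  the condition consists of countably many conditions on \<open>t\<close> and on \<open>\<phi>\<close> separately, which makes it
  jointly measurable.
\<close>
lemma gilbert_nonempty_iff_counts:
  assumes "locally_finite_set \<phi>"
  shows "gilbert (\<phi> \<inter> {1..w - t}) \<noteq> {} \<longleftrightarrow>
    (\<forall>m::nat. \<exists>q p::rat. \<bar>t - of_rat p\<bar> < 1 / real (Suc m) \<and>
       2 \<le> card (\<phi> \<inter> {max (of_rat q) 1..min (of_rat q + 1 + 1 / real (Suc m)) (w - of_rat p)}))"
    (is "?edge \<longleftrightarrow> (\<forall>m. \<exists>q p. ?near m p \<and> 2 \<le> card (?window m q p))")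
proof
  assume ?edge
  then obtain x y where xy: "x \<in> \<phi>" "y \<in> \<phi>" "x < y" "y \<le> x + 1" "1 \<le> x" "y \<le> w - t"
    by (auto simp: gilbert_eq_empty_iff not_less)
  show "\<forall>m. \<exists>q p. ?near m p \<and> 2 \<le> card (?window m q p)"
  proof
    fix m :: nat
    define d where "d = 1 / real (Suc m)"
    have "0 < d"
      by (simp add: d_def)
    obtain q :: rat where q: "x - d < of_rat q" "of_rat q < x"
      using of_rat_dense[of "x - d" x] \<open>0 < d\<close> by auto
    (* p lies below t, so that the window still reaches up to w - t. *)
    obtain p :: rat where p: "t - d < of_rat p" "of_rat p < t"
      using of_rat_dense[of "t - d" t] \<open>0 < d\<close> by auto
    have "finite (?window m q p)"
      using assms by (rule locally_finite_set_Int_bounded) simp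
    moreover have "{x, y} \<subseteq> ?window m q p"
      using xy p q unfolding d_def[symmetric] by auto
    ultimately have "card {x, y} \<le> card (?window m q p)"
      by (rule card_mono)
    then have "2 \<le> card (?window m q p)"
      using xy by simp
    moreover have "?near m p"
      using p unfolding d_def[symmetric] by auto
    ultimately show "\<exists>q p. ?near m p \<and> 2 \<le> card (?window m q p)"
      by blast
  qed
next
  assume *: "\<forall>m. \<exists>q p. ?near m p \<and> 2 \<le> card (?window m q p)"
  show ?edge
  proof (rule ccontr)
    assume "\<not> ?edge"
    then have no_edge: "x + 1 < y \<or> w - t < y" if "x \<in> \<phi>" "y \<in> \<phi>" "1 \<le> x" "x < y" for x y
      using that unfolding not_not gilbert_eq_empty_iff by force
    define K where "K = \<phi> \<inter> {1..w - t + 1}"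
    have "finite (K \<times> K)"
      unfolding K_def using assms by (intro finite_cartesian_product locally_finite_set_Int_bounded) auto
    then have "\<forall>\<^sub>F m in sequentially. \<forall>z\<in>K \<times> K.
        fst z < snd z \<longrightarrow> fst z + 1 + 1 / real (Suc m) < snd z \<or> w - t + 1 / real (Suc m) < snd z"
    proof (rule eventually_ball_finite, intro ballI)
      fix z assume z: "z \<in> K \<times> K"
      have lim: "(\<lambda>m. c + 1 / real (Suc m)) \<longlonglongrightarrow> c" for c
        using tendsto_add[OF tendsto_const LIMSEQ_Suc[OF lim_1_over_n], of c] by simp
      show "\<forall>\<^sub>F m in sequentially.
          fst z < snd z \<longrightarrow> fst z + 1 + 1 / real (Suc m) < snd z \<or> w - t + 1 / real (Suc m) < snd z"
      proof (cases "fst z < snd z")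
        case True
        then have "fst z + 1 < snd z \<or> w - t < snd z"
          using no_edge[of "fst z" "snd z"] z by (auto simp: K_def)
        then show ?thesis
          using order_tendstoD(2)[OF lim, of "fst z + 1" "snd z"] order_tendstoD(2)[OF lim, of "w - t" "snd z"]
          by (elim disjE) (auto elim: eventually_mono)
      qed simp
    qed
    then obtain m where m: "\<And>x y. x \<in> K \<Longrightarrow> y \<in> K \<Longrightarrow> x < y \<Longrightarrow>
        x + 1 + 1 / real (Suc m) < y \<or> w - t + 1 / real (Suc m) < y"
      by (fastforce simp: eventually_sequentially)
    from * obtain q p where qp: "?near m p" "2 \<le> card (?window m q p)"
      by blast
    obtain x y where "x \<in> ?window m q p" "y \<in> ?window m q p" "x \<noteq> y"
      using qp(2) by (metis card_le_Suc0_iff_eq card.infinite not_less_eq_eq numeral_2_eq_2 zero_le)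
    then obtain x y where xy: "x \<in> ?window m q p" "y \<in> ?window m q p" "x < y"
      by (metis linorder_neqE)
    define d where "d = 1 / real (Suc m)"
    have d: "d \<le> 1"
      by (simp add: d_def)
    have x: "x \<in> \<phi>" "1 \<le> x" "of_rat q \<le> x" and y: "y \<in> \<phi>" "y \<le> of_rat q + 1 + d" "y \<le> w - of_rat p"
      using xy unfolding d_def by simp_all
    have p: "t - of_rat p < d" "of_rat p - t < d"
      using qp(1) unfolding d_def[symmetric] by linarith+
    have "y \<le> w - t + 1"
      using y p d by linarith
    then have "x \<in> K" "y \<in> K"
      using x y xy(3) by (auto simp: K_def)
    from m[OF this xy(3)] show False
      using x y p unfolding d_def[symmetric] by linarith
  qed
qed

lemma sets_no_edge:
  "{z \<in> space (borel \<Otimes>\<^sub>M config_space). gilbert (snd z \<inter> {1..w - fst z}) = {}}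
     \<in> sets (borel \<Otimes>\<^sub>M config_space)"
proof -
  let ?N = "borel \<Otimes>\<^sub>M config_space :: (real \<times> real set) measure"
  have [measurable]: "(\<lambda>z. card (snd z \<inter> {a..b})) \<in> ?N \<rightarrow>\<^sub>M count_space UNIV" for a b :: real
    by (rule measurable_compose[OF measurable_snd measurable_card_config]) auto
  have "{z \<in> space ?N. gilbert (snd z \<inter> {1..w - fst z}) = {}} = {z \<in> space ?N.
      \<not> (\<forall>m::nat. \<exists>q p::rat. \<bar>fst z - of_rat p\<bar> < 1 / real (Suc m) \<and>
       2 \<le> card (snd z \<inter> {max (of_rat q) 1..min (of_rat q + 1 + 1 / real (Suc m)) (w - of_rat p)}))}"
    by (intro Collect_cong conj_cong refl, subst gilbert_nonempty_iff_counts[symmetric])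
       (auto simp: space_pair_measure space_config_space)
  also have "\<dots> \<in> sets ?N"
    by measurable
  finally show ?thesis .
qed

section \<open>The points at distance at least one\<close>

context first_poisson_point
begin

definition later :: "'a \<Rightarrow> real set" where
  "later \<omega> = {x - T \<omega> | x. x \<in> \<Phi> \<omega>} \<inter> {1..}"

lemma locally_finite_later:
  assumes "\<omega> \<in> space M"
  shows "locally_finite_set (later \<omega>)"
  unfolding locally_finite_set_def
proof (intro allI impI)
  fix B :: "real set" assume "bounded B"
  then have "finite (\<Phi> \<omega> \<inter> (+) (T \<omega>) ` B)"
    by (intro locally_finite_set_Int_bounded locally_finite_process assms bounded_translation)
  moreover have "later \<omega> \<inter> B \<subseteq> (\<lambda>x. x - T \<omega>) ` (\<Phi> \<omega> \<inter> (+) (T \<omega>) ` B)"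
    unfolding later_def by force
  ultimately show "finite (later \<omega> \<inter> B)"
    by (rule finite_surj)
qed

text \<open>
  The later part is closed at distance \<open>1\<close> while half-open intervals are not; a point at \<open>T + 1\<close>
  accounts for the difference.
\<close>
lemma card_later_Ioc:
  assumes "\<omega> \<in> space M"
  shows "card (later \<omega> \<inter> {a<..b}) = card (\<Phi> \<omega> \<inter> {T \<omega> + max a 1<..T \<omega> + max b 1})
    + of_bool (T \<omega> + 1 \<in> \<Phi> \<omega> \<and> a < 1 \<and> 1 \<le> b)"
proof -
  let ?I = "\<Phi> \<omega> \<inter> {T \<omega> + max a 1<..T \<omega> + max b 1}"
  let ?E = "if T \<omega> + 1 \<in> \<Phi> \<omega> \<and> a < 1 \<and> 1 \<le> b then {T \<omega> + 1} else {}"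
  have fin: "finite ?I"
    using locally_finite_process[OF assms] by (rule locally_finite_set_Int_bounded) simp
  have "later \<omega> \<inter> {a<..b} = (\<lambda>x. x - T \<omega>) ` (?I \<union> ?E)"
  proof (intro antisym subsetI)
    fix y assume y: "y \<in> later \<omega> \<inter> {a<..b}"
    then obtain x where x: "x \<in> \<Phi> \<omega>" "x = T \<omega> + y"
      by (auto simp: later_def)
    with y have "T \<omega> + y \<in> ?I \<union> ?E"
      by (cases "y = 1") (auto simp: later_def)
    then show "y \<in> (\<lambda>x. x - T \<omega>) ` (?I \<union> ?E)"
      by (rule rev_image_eqI) simp
  next
    fix y assume "y \<in> (\<lambda>x. x - T \<omega>) ` (?I \<union> ?E)"
    then show "y \<in> later \<omega> \<inter> {a<..b}"
      by (force simp: later_def max_def split: if_splits)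
  qed
  then have "card (later \<omega> \<inter> {a<..b}) = card (?I \<union> ?E)"
    by (simp add: card_image inj_on_def)
  also have "\<dots> = card ?I + card ?E"
    using fin by (intro card_Un_disjoint) auto
  finally show ?thesis
    by simp
qed

text \<open>
  Expresses the point at \<open>T + 1\<close> by counts over shrinking half-open intervals, whose measurability and
  void probabilities are known.
\<close>
lemma point_at_distance_one_iff:
  assumes "\<omega> \<in> space M"
  shows "T \<omega> + 1 \<in> \<Phi> \<omega> \<longleftrightarrow> (\<forall>m::nat. card (\<Phi> \<omega> \<inter> {T \<omega> + 1 - 1 / real (Suc m)<..T \<omega> + 1}) \<noteq> 0)"
    (is "_ \<longleftrightarrow> (\<forall>m. card (?W m) \<noteq> 0)")
proof -
  have fin: "finite (?W m)" for m
    using locally_finite_process[OF assms] by (rule locally_finite_set_Int_bounded) simp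
  show ?thesis
  proof (intro iffI allI)
    fix m assume "T \<omega> + 1 \<in> \<Phi> \<omega>"
    then have "T \<omega> + 1 \<in> ?W m"
      by simp
    then show "card (?W m) \<noteq> 0"
      using fin by (metis card_0_eq empty_iff)
  next
    assume *: "\<forall>m. card (?W m) \<noteq> 0"
    show "T \<omega> + 1 \<in> \<Phi> \<omega>"
    proof (rule ccontr)
      assume out: "T \<omega> + 1 \<notin> \<Phi> \<omega>"
      have "\<forall>\<^sub>F m in sequentially. \<forall>x\<in>?W 0. x < T \<omega> + 1 - 1 / real (Suc m)"
      proof (rule eventually_ball_finite[OF fin], intro ballI)
        fix x assume "x \<in> ?W 0"
        with out have "x < T \<omega> + 1"
          by (auto simp: less_le)
        moreover have "(\<lambda>m. T \<omega> + 1 - 1 / real (Suc m)) \<longlonglongrightarrow> T \<omega> + 1"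
          using tendsto_diff[OF tendsto_const LIMSEQ_Suc[OF lim_1_over_n], of "T \<omega> + 1"] by simp
        ultimately show "\<forall>\<^sub>F m in sequentially. x < T \<omega> + 1 - 1 / real (Suc m)"
          by (rule order_tendstoD(1)[rotated])
      qed
      then obtain m where m: "\<forall>x\<in>?W 0. x < T \<omega> + 1 - 1 / real (Suc m)"
        unfolding eventually_sequentially by blast
      have "1 / real (Suc m) \<le> 1 / real (Suc 0)"
        by simp
      then have "?W m \<subseteq> ?W 0"
        by (auto simp del: of_nat_Suc)
      then have "x \<notin> ?W m" for x
        using m by (meson IntD2 greaterThanAtMost_iff less_asym subsetD)
      then have "?W m = {}"
        by blast
      with * show False
        by (metis card.empty)
    qed
  qed
qed

lemma measurable_point_at_distance_one [measurable]:
  "Measurable.pred M (\<lambda>\<omega>. T \<omega> + 1 \<in> \<Phi> \<omega>)"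
proof -
  have [measurable]: "(\<lambda>\<omega>. card (\<Phi> \<omega> \<inter> {T \<omega> + 1 - 1 / real (Suc m)<..T \<omega> + 1})) \<in> M \<rightarrow>\<^sub>M count_space UNIV" for m
    by (rule measurable_count_first) (auto intro!: monoI)
  have "Measurable.pred M (\<lambda>\<omega>. \<forall>m::nat. card (\<Phi> \<omega> \<inter> {T \<omega> + 1 - 1 / real (Suc m)<..T \<omega> + 1}) \<noteq> 0)"
    by measurable
  then show ?thesis
    by (subst measurable_cong[OF point_at_distance_one_iff])
qed

text \<open>
  By \<open>void_after_first\<close>, the interval \<open>(T + 1 - 1 / (m + 1), T + 1]\<close> contains a point with
  probability \<open>1 - exp (- rate / (m + 1))\<close>, which tends to \<open>0\<close>.
\<close>
lemma AE_no_point_at_distance_one: "AE \<omega> in M. T \<omega> + 1 \<notin> \<Phi> \<omega>"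
proof -
  let ?P = "{\<omega> \<in> space M. T \<omega> + 1 \<in> \<Phi> \<omega>}"
  let ?V = "\<lambda>m. {\<omega> \<in> space M. card (\<Phi> \<omega> \<inter> {T \<omega> + 1 - 1 / real (Suc m)<..T \<omega> + 1}) = 0}"
  have meas[measurable]: "(\<lambda>\<omega>. card (\<Phi> \<omega> \<inter> {T \<omega> + 1 - 1 / real (Suc m)<..T \<omega> + 1})) \<in> M \<rightarrow>\<^sub>M count_space UNIV" for m
    by (rule measurable_count_first) (auto intro!: monoI)
  have bound: "prob ?P \<le> 1 - exp (- rate * (1 / real (Suc m)))" for m
  proof -
    have "emeasure M (?V m) = (\<integral>\<^sup>+\<omega>. indicator (?V m) \<omega> \<partial>M)"
      by (rule nn_integral_indicator[symmetric]) measurable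
    also have "\<dots> = (\<integral>\<^sup>+\<omega>. ennreal (of_bool (0 \<le> T \<omega> \<and> card (\<Phi> \<omega> \<inter> {T \<omega> + 1 - 1 / real (Suc m)<..T \<omega> + 1}) = 0 \<and>
        counts_after {} (T \<omega>) (\<Phi> \<omega>))) \<partial>M)"
      by (rule nn_integral_cong) (simp add: counts_after_def first_nonneg indicator_def)
    also have "\<dots> = (\<integral>\<^sup>+\<omega>. ennreal (exp (- rate * ((T \<omega> + 1) - (T \<omega> + 1 - 1 / real (Suc m)))) *
        of_bool (0 \<le> T \<omega> \<and> counts_after {} (T \<omega>) (\<Phi> \<omega>))) \<partial>M)"
      by (rule void_after_first) (auto intro!: monoI)
    also have "\<dots> = (\<integral>\<^sup>+\<omega>. ennreal (exp (- rate * (1 / real (Suc m)))) \<partial>M)"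
      by (rule nn_integral_cong) (simp add: counts_after_def first_nonneg)
    also have "\<dots> = ennreal (exp (- rate * (1 / real (Suc m))))"
      by (simp add: emeasure_space_1)
    finally have "prob (?V m) = exp (- rate * (1 / real (Suc m)))"
      by (simp add: emeasure_eq_measure)
    moreover have "prob ?P \<le> prob (space M - ?V m)"
    proof (rule finite_measure_mono)
      show "?P \<subseteq> space M - ?V m"
        using point_at_distance_one_iff by blast
    qed measurable
    moreover have "prob (space M - ?V m) = 1 - prob (?V m)"
      by (rule prob_compl) measurable
    ultimately show ?thesis
      by simp
  qed
  have "(\<lambda>m. 1 - exp (- rate * (1 / real (Suc m)))) \<longlonglongrightarrow> 1 - exp (- rate * 0)"
    by (intro tendsto_intros LIMSEQ_Suc[OF lim_1_over_n])
  then have "prob ?P \<le> 1 - exp (- rate * 0)"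
    using bound by (intro LIMSEQ_le_const) auto
  then have "prob ?P = 0"
    using measure_nonneg[of M ?P] by simp
  then show ?thesis
    by (subst AE_iff_measurable[OF _ refl]) (simp_all add: emeasure_eq_measure)
qed

lemma measurable_card_later [measurable]:
  "(\<lambda>\<omega>. card (later \<omega> \<inter> {a<..b})) \<in> M \<rightarrow>\<^sub>M count_space UNIV"
proof -
  have [measurable]: "(\<lambda>\<omega>. card (\<Phi> \<omega> \<inter> {T \<omega> + max a 1<..T \<omega> + max b 1})) \<in> M \<rightarrow>\<^sub>M count_space UNIV"
    by (rule measurable_count_first) (auto intro!: monoI)
  have "(\<lambda>\<omega>. card (\<Phi> \<omega> \<inter> {T \<omega> + max a 1<..T \<omega> + max b 1})
      + of_bool (T \<omega> + 1 \<in> \<Phi> \<omega> \<and> a < 1 \<and> 1 \<le> b)) \<in> M \<rightarrow>\<^sub>M count_space UNIV"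
    unfolding of_bool_def by measurable
  then show ?thesis
    by (subst measurable_cong[OF card_later_Ioc])
qed

lemma measurable_later [measurable]: "later \<in> M \<rightarrow>\<^sub>M config_space"
proof (rule measurable_sigma_sets[OF sets_config_space])
  show "count_cylinders \<subseteq> Pow {\<phi>. locally_finite_set \<phi>}"
    by (auto simp: count_cylinders_def count_cylinder_def)
  show "later \<in> space M \<rightarrow> {\<phi>. locally_finite_set \<phi>}"
    using locally_finite_later by auto
  fix C assume "C \<in> count_cylinders"
  then obtain J where J: "finite J" "C = count_cylinder J"
    by (auto simp: count_cylinders_def)
  have "Measurable.pred M (\<lambda>\<omega>. \<forall>z\<in>J. card (later \<omega> \<inter> {fst z<..fst (snd z)}) = snd (snd z))"
    by (rule pred_intros_finite(3)[OF J(1)]) measurable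
  moreover have "later -` C \<inter> space M
      = {\<omega> \<in> space M. \<forall>z\<in>J. card (later \<omega> \<inter> {fst z<..fst (snd z)}) = snd (snd z)}"
    by (auto simp: J(2) count_cylinder_def locally_finite_later case_prod_beta)
  ultimately show "later -` C \<inter> space M \<in> sets M"
    by (simp add: pred_def)
qed

end

section \<open>The conditional probability of no edge\<close>

lemma sets_threshold_cylinder:
  "sets (borel \<Otimes>\<^sub>M config_space) = sigma_sets (UNIV \<times> {\<phi>. locally_finite_set \<phi>})
     {{t..} \<times> C | (t::real) C. C \<in> count_cylinders}"
proof -
  let ?L = "{\<phi>. locally_finite_set \<phi>}"
  have cyl: "count_cylinders \<subseteq> Pow ?L" "?L \<in> count_cylinders"
    by (auto simp: count_cylinders_def count_cylinder_def intro!: image_eqI[of _ _ "{}"])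
  have thr: "(\<Union>n::nat. {- real n..}) = UNIV"
    by (auto, metis add.inverse_inverse neg_le_iff_le real_arch_simple)
  have "sets (borel \<Otimes>\<^sub>M config_space) = sets (sigma (space borel \<times> space config_space)
      {a \<times> b | a b. a \<in> range (\<lambda>t::real. {t..}) \<and> b \<in> count_cylinders})"
  proof (rule sets_pair_eq)
    show "range (\<lambda>t::real. {t..}) \<subseteq> Pow (space borel)" "sets borel = sigma_sets (space borel) (range (\<lambda>t::real. {t..}))"
      by (simp_all add: borel_Ici)
    show "count_cylinders \<subseteq> Pow (space config_space)" "sets config_space = sigma_sets (space config_space) count_cylinders"
      using cyl by (simp_all add: space_config_space sets_config_space)
    show "countable (range (\<lambda>n::nat. {- real n..}))" "range (\<lambda>n::nat. {- real n..}) \<subseteq> range (\<lambda>t::real. {t..})"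
      "\<Union> (range (\<lambda>n::nat. {- real n..})) = space borel"
      using thr by auto
    show "countable {?L}" "{?L} \<subseteq> count_cylinders" "\<Union> {?L} = space config_space"
      using cyl by (simp_all add: space_config_space)
  qed
  also have "space borel \<times> space config_space = UNIV \<times> ?L"
    by (simp add: space_config_space)
  also have "{a \<times> b | a b. a \<in> range (\<lambda>x::real. {x..}) \<and> b \<in> count_cylinders}
      = {{t..} \<times> C | t C. C \<in> count_cylinders}"
    by auto
  also have "sets (sigma (UNIV \<times> ?L) {{t..} \<times> C | (t::real) C. C \<in> count_cylinders})
      = sigma_sets (UNIV \<times> ?L) {{t..} \<times> C | t C. C \<in> count_cylinders}"
    using cyl(1) by (intro sets_measure_of) blast
  finally show ?thesis .
qed

lemma Int_stable_threshold_cylinder: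
  "Int_stable {{t..} \<times> C | (t::real) C. C \<in> count_cylinders}"
proof (rule Int_stableI)
  fix A B :: "(real \<times> real set) set"
  assume "A \<in> {{t..} \<times> C | t C. C \<in> count_cylinders}" "B \<in> {{t..} \<times> C | t C. C \<in> count_cylinders}"
  then obtain s C t D where *: "A = {s..} \<times> C" "B = {t..} \<times> D" "C \<in> count_cylinders" "D \<in> count_cylinders"
    by blast
  have "A \<inter> B = {max s t..} \<times> (C \<inter> D)"
    using * by auto
  moreover have "C \<inter> D \<in> count_cylinders"
    using Int_stable_count_cylinders * by (auto simp: Int_stable_def)
  ultimately show "A \<inter> B \<in> {{t..} \<times> C | t C. C \<in> count_cylinders}"
    by blast
qed

context first_poisson_point
begin

lemma AE_counts_after_iff_later:
  "AE \<omega> in M. later \<omega> \<in> count_cylinder J \<longleftrightarrow> counts_after ((\<lambda>(a, b, k). (max a 1, max b 1, k)) ` J) (T \<omega>) (\<Phi> \<omega>)"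
  using AE_no_point_at_distance_one AE_space
proof eventually_elim
  case (elim \<omega>)
  then show ?case
    by (simp add: count_cylinder_def counts_after_def locally_finite_later card_later_Ioc case_prod_beta)
qed

text \<open>
  Both sides, as functions of \<open>S\<close>, are finite measures: images under \<open>(T, later)\<close> of measures with a
  density. They agree on the intersection-stable generator of thresholds and cylinders by
  \<open>void_after_first\<close>, hence everywhere.
\<close>
proposition void_given_later:
  assumes mono: "mono e" and cont: "\<And>t. isCont e t"
    and bounds: "\<And>t. 0 \<le> t \<Longrightarrow> t \<le> e t \<and> e t \<le> t + 1"
    and S: "S \<in> sets (borel \<Otimes>\<^sub>M config_space)"
  shows "(\<integral>\<^sup>+\<omega>. ennreal (of_bool (card (\<Phi> \<omega> \<inter> {T \<omega><..e (T \<omega>)}) = 0)) * indicator S (T \<omega>, later \<omega>) \<partial>M)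
       = (\<integral>\<^sup>+\<omega>. ennreal (exp (- rate * (e (T \<omega>) - T \<omega>))) * indicator S (T \<omega>, later \<omega>) \<partial>M)"
proof -
  let ?N = "borel \<Otimes>\<^sub>M config_space :: (real \<times> real set) measure"
  let ?v = "\<lambda>\<omega>. ennreal (of_bool (card (\<Phi> \<omega> \<inter> {T \<omega><..e (T \<omega>)}) = 0))"
  let ?x = "\<lambda>\<omega>. ennreal (exp (- rate * (e (T \<omega>) - T \<omega>)))"
  let ?D = "\<lambda>f. distr (density M f) ?N (\<lambda>\<omega>. (T \<omega>, later \<omega>))"
  have [measurable]: "e \<in> borel_measurable borel"
    using mono by (rule borel_measurable_mono)
  have [measurable]: "(\<lambda>\<omega>. card (\<Phi> \<omega> \<inter> {T \<omega><..e (T \<omega>)})) \<in> M \<rightarrow>\<^sub>M count_space UNIV"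
    by (rule measurable_count_first[OF _ mono _ cont]) (auto intro!: monoI)
  have D: "emeasure (?D f) A = (\<integral>\<^sup>+\<omega>. f \<omega> * indicator A (T \<omega>, later \<omega>) \<partial>M)"
    if [measurable]: "f \<in> borel_measurable M" "A \<in> sets ?N" for f A
  proof -
    have "emeasure (?D f) A = emeasure (density M f) ((\<lambda>\<omega>. (T \<omega>, later \<omega>)) -` A \<inter> space M)"
      by (subst emeasure_distr) simp_all
    also have "\<dots> = (\<integral>\<^sup>+\<omega>. f \<omega> * indicator ((\<lambda>\<omega>. (T \<omega>, later \<omega>)) -` A \<inter> space M) \<omega> \<partial>M)"
      by (rule emeasure_density) measurable
    also have "\<dots> = (\<integral>\<^sup>+\<omega>. f \<omega> * indicator A (T \<omega>, later \<omega>) \<partial>M)"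
      by (rule nn_integral_cong) (simp add: indicator_def)
    finally show ?thesis .
  qed
  have "?D ?v = ?D ?x"
  proof (rule measure_eqI_generator_eq[OF Int_stable_threshold_cylinder])
    let ?L = "{\<phi>. locally_finite_set \<phi>}"
    let ?E = "{{t..} \<times> C | (t::real) C. C \<in> count_cylinders}"
    have L: "?L \<in> count_cylinders"
      by (auto simp: count_cylinders_def count_cylinder_def intro!: image_eqI[of _ _ "{}"])
    show "?E \<subseteq> Pow (UNIV \<times> ?L)"
      by (auto simp: count_cylinders_def count_cylinder_def)
    show "sets (?D ?v) = sigma_sets (UNIV \<times> ?L) ?E" "sets (?D ?x) = sigma_sets (UNIV \<times> ?L) ?E"
      by (simp_all add: sets_threshold_cylinder)
    show "range (\<lambda>n::nat. {- real n..} \<times> ?L) \<subseteq> ?E"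
      using L by blast
    have "(\<Union>n::nat. {- real n..}) = UNIV"
      by (auto, metis add.inverse_inverse neg_le_iff_le real_arch_simple)
    then show "(\<Union>n::nat. {- real n..} \<times> ?L) = UNIV \<times> ?L"
      by blast
    interpret V: finite_measure "?D ?v"
    proof (rule finite_measureI)
      have "emeasure (?D ?v) (space (?D ?v)) \<le> (\<integral>\<^sup>+\<omega>. 1 \<partial>M)"
        by (subst D) (auto simp: indicator_def simp del: nn_integral_const intro!: nn_integral_mono)
      then show "emeasure (?D ?v) (space (?D ?v)) \<noteq> \<infinity>"
        by (auto simp: emeasure_space_1 top_unique)
    qed
    show "emeasure (?D ?v) ({- real n..} \<times> ?L) \<noteq> \<infinity>" for n
      by simp
    fix A assume "A \<in> ?E"
    then obtain t0 J where A: "A = {t0..} \<times> count_cylinder J" "finite J"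
      by (auto simp: count_cylinders_def)
    then have "A \<in> sets ?N"
      unfolding sets_threshold_cylinder by (intro sigma_sets.Basic) (auto simp: count_cylinders_def)
    define K where "K = (\<lambda>(a, b, k). (max a 1, max b 1, k)) ` J"
    have K: "finite K" "\<And>a b k. (a, b, k) \<in> K \<Longrightarrow> 1 \<le> a"
      using A(2) by (auto simp: K_def)
    have "emeasure (?D ?v) A = (\<integral>\<^sup>+\<omega>. ?v \<omega> * indicator A (T \<omega>, later \<omega>) \<partial>M)"
      using \<open>A \<in> sets ?N\<close> by (intro D) measurable
    also have "\<dots> = (\<integral>\<^sup>+\<omega>. ennreal (of_bool (t0 \<le> T \<omega> \<and> card (\<Phi> \<omega> \<inter> {T \<omega><..e (T \<omega>)}) = 0 \<and>
        counts_after K (T \<omega>) (\<Phi> \<omega>))) \<partial>M)"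
      using AE_counts_after_iff_later[of J, folded K_def]
      by (intro nn_integral_cong_AE, eventually_elim) (auto simp: A indicator_def)
    also have "\<dots> = (\<integral>\<^sup>+\<omega>. ennreal (exp (- rate * (e (T \<omega>) - T \<omega>)) *
        of_bool (t0 \<le> T \<omega> \<and> counts_after K (T \<omega>) (\<Phi> \<omega>))) \<partial>M)"
      by (rule void_after_first[of "\<lambda>t. t"]) (use mono cont bounds K in \<open>auto intro!: monoI\<close>)
    also have "\<dots> = (\<integral>\<^sup>+\<omega>. ?x \<omega> * indicator A (T \<omega>, later \<omega>) \<partial>M)"
      using AE_counts_after_iff_later[of J, folded K_def]
      by (intro nn_integral_cong_AE, eventually_elim) (auto simp: A indicator_def)
    also have "\<dots> = emeasure (?D ?x) A"
      using \<open>A \<in> sets ?N\<close> by (intro D[symmetric]) measurable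
    finally show "emeasure (?D ?v) A = emeasure (?D ?x) A" .
  qed
  then have "emeasure (?D ?v) S = emeasure (?D ?x) S"
    by simp
  then show ?thesis
    using S by (simp add: D)
qed

text \<open>
  Holds for every configuration, not just almost surely. If \<open>T\<close> has no neighbour in the window, every
  other point of the window is farther than \<open>1\<close> from \<open>T\<close>, so it belongs to the later part. If \<open>w < T\<close>,
  the window is empty, and so are the interval and the later part of the window.
\<close>
lemma gilbert_window_eq_empty_iff:
  assumes "\<omega> \<in> space M"
  shows "gilbert (\<Phi> \<omega> \<inter> {0..w}) = {} \<longleftrightarrow>
    card (\<Phi> \<omega> \<inter> {T \<omega><..max (T \<omega>) (min (T \<omega> + 1) w)}) = 0 \<and> gilbert (later \<omega> \<inter> {1..w - T \<omega>}) = {}"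
    (is "_ \<longleftrightarrow> card ?V = 0 \<and> _")
proof -
  have "finite ?V"
    using locally_finite_process[OF assms] by (rule locally_finite_set_Int_bounded) simp
  then have "card ?V = 0 \<longleftrightarrow> ?V = {}"
    by (rule card_0_eq)
  then have V: "card ?V = 0 \<longleftrightarrow> (\<forall>x\<in>\<Phi> \<omega>. \<not> (T \<omega> < x \<and> x \<le> max (T \<omega>) (min (T \<omega> + 1) w)))"
    unfolding disjoint_iff greaterThanAtMost_iff by blast
  have later: "gilbert (later \<omega> \<inter> {1..w - T \<omega>}) = {} \<longleftrightarrow>
      (\<forall>x\<in>\<Phi> \<omega>. \<forall>y\<in>\<Phi> \<omega>. T \<omega> + 1 \<le> x \<longrightarrow> y \<le> w \<longrightarrow> x < y \<longrightarrow> x + 1 < y)"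
    (is "_ \<longleftrightarrow> ?R")
  proof
    assume *: "gilbert (later \<omega> \<inter> {1..w - T \<omega>}) = {}"
    show ?R
    proof (intro ballI impI)
      fix x y assume xy: "x \<in> \<Phi> \<omega>" "y \<in> \<Phi> \<omega>" "T \<omega> + 1 \<le> x" "y \<le> w" "x < y"
      then have "x - T \<omega> \<in> later \<omega> \<inter> {1..w - T \<omega>}" "y - T \<omega> \<in> later \<omega> \<inter> {1..w - T \<omega>}"
        by (auto simp: later_def)
      then have "x - T \<omega> + 1 < y - T \<omega>"
        using * xy(5) unfolding gilbert_eq_empty_iff by (metis diff_strict_right_mono)
      then show "x + 1 < y"
        by simp
    qed
  next
    assume R: ?R
    show "gilbert (later \<omega> \<inter> {1..w - T \<omega>}) = {}"
      unfolding gilbert_eq_empty_iff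
    proof (intro ballI impI)
      fix u v assume uv: "u \<in> later \<omega> \<inter> {1..w - T \<omega>}" "v \<in> later \<omega> \<inter> {1..w - T \<omega>}" "u < v"
      then obtain x y where xy: "x \<in> \<Phi> \<omega>" "u = x - T \<omega>" "y \<in> \<Phi> \<omega>" "v = y - T \<omega>"
        by (auto simp: later_def)
      then have "x + 1 < y"
        using R uv by auto
      then show "u + 1 < v"
        using xy by simp
    qed
  qed
  have win: "gilbert (\<Phi> \<omega> \<inter> {0..w}) = {} \<longleftrightarrow> (\<forall>x\<in>\<Phi> \<omega>. \<forall>y\<in>\<Phi> \<omega>. y \<le> w \<longrightarrow> x < y \<longrightarrow> x + 1 < y)"
    unfolding gilbert_eq_empty_iff using process_nonneg[OF assms] by auto
  show ?thesis
    unfolding V later win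
  proof (intro iffI conjI)
    assume *: "\<forall>x\<in>\<Phi> \<omega>. \<forall>y\<in>\<Phi> \<omega>. y \<le> w \<longrightarrow> x < y \<longrightarrow> x + 1 < y"
    show "\<forall>x\<in>\<Phi> \<omega>. \<not> (T \<omega> < x \<and> x \<le> max (T \<omega>) (min (T \<omega> + 1) w))"
      using * first_in[OF assms] by force
    show ?R
      using * by blast
  next
    assume *: "(\<forall>x\<in>\<Phi> \<omega>. \<not> (T \<omega> < x \<and> x \<le> max (T \<omega>) (min (T \<omega> + 1) w))) \<and> ?R"
    show "\<forall>x\<in>\<Phi> \<omega>. \<forall>y\<in>\<Phi> \<omega>. y \<le> w \<longrightarrow> x < y \<longrightarrow> x + 1 < y"
    proof (intro ballI impI)
      fix x y assume xy: "x \<in> \<Phi> \<omega>" "y \<in> \<Phi> \<omega>" "y \<le> w" "x < y"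
      have gap: "T \<omega> + 1 < z" if "z \<in> \<Phi> \<omega>" "z \<le> w" "T \<omega> < z" for z
        using * that by (force simp: min_def max_def not_le split: if_splits)
      show "x + 1 < y"
      proof (cases "x = T \<omega>")
        case True
        then show ?thesis
          using gap xy by auto
      next
        case False
        then have "T \<omega> + 1 < x"
          using gap[of x] first_le[OF assms, of x] xy by auto
        then show ?thesis
          using * xy by auto
      qed
    qed
  qed
qed

text \<open>
  The event that the later part has no edge is \<open>F\<close>-measurable, so it can be absorbed into the test
  set of the defining property of conditional expectation; \<open>void_given_later\<close> does the rest.
\<close>
theorem cond_prob_no_edge:
  fixes w :: real
  defines "F \<equiv> vimage_algebra (space M) (\<lambda>\<omega>. (T \<omega>, later \<omega>)) (borel \<Otimes>\<^sub>M config_space)"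
    and "E \<equiv> {\<omega> \<in> space M. gilbert (\<Phi> \<omega> \<inter> {0..w}) = {}}"
  shows "AE \<omega> in M. real_cond_exp M F (indicator E) \<omega> =
           exp (- rate * min (max (w - T \<omega>) 0) 1) *
           indicator {\<omega> \<in> space M. gilbert (later \<omega> \<inter> {1..w - T \<omega>}) = {}} \<omega>"
proof -
  let ?N = "borel \<Otimes>\<^sub>M config_space :: (real \<times> real set) measure"
  (* Right end of the gap; its length e t - t is min (max (w - t) 0) 1. *)
  define e where "e t = max t (min (t + 1) w)" for t :: real
  define S where "S = {z \<in> space ?N. gilbert (snd z \<inter> {1..w - fst z}) = {}}"
  let ?g = "\<lambda>\<omega>. exp (- rate * (e (T \<omega>) - T \<omega>)) * indicator S (T \<omega>, later \<omega>) :: real"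
  have S[measurable]: "S \<in> sets ?N"
    unfolding S_def by (rule sets_no_edge)
  have pair[measurable]: "(\<lambda>\<omega>. (T \<omega>, later \<omega>)) \<in> M \<rightarrow>\<^sub>M ?N"
    by measurable
  have pair_space: "(\<lambda>\<omega>. (T \<omega>, later \<omega>)) \<in> space M \<rightarrow> space ?N"
    using measurable_space[OF pair] by auto
  have e_mono: "mono e"
    by (auto simp: e_def intro!: monoI)
  have e_cont: "isCont e t" for t
    unfolding e_def by (intro continuous_intros)
  have e_bounds: "t \<le> e t \<and> e t \<le> t + 1" for t
    by (auto simp: e_def)
  have [measurable]: "e \<in> borel_measurable borel"
    unfolding e_def by measurable
  have [measurable]: "(\<lambda>\<omega>. card (\<Phi> \<omega> \<inter> {T \<omega><..e (T \<omega>)})) \<in> M \<rightarrow>\<^sub>M count_space UNIV"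
    by (rule measurable_count_first[OF _ e_mono _ e_cont]) (auto intro!: monoI)
  have no_edge: "\<omega> \<in> E \<longleftrightarrow> card (\<Phi> \<omega> \<inter> {T \<omega><..e (T \<omega>)}) = 0 \<and> (T \<omega>, later \<omega>) \<in> S"
    if "\<omega> \<in> space M" for \<omega>
    using that gilbert_window_eq_empty_iff[OF that, of w] pair_space unfolding E_def S_def e_def by auto
  have "E = {\<omega> \<in> space M. card (\<Phi> \<omega> \<inter> {T \<omega><..e (T \<omega>)}) = 0 \<and> (T \<omega>, later \<omega>) \<in> S}"
    using no_edge by (auto simp: E_def)
  also have "\<dots> \<in> sets M"
    by measurable
  finally have E[measurable]: "E \<in> sets M" .
  interpret F: finite_measure_subalgebra M F
  proof
    show "subalgebra M F"
      unfolding subalgebra_def F_def using sets_image_in_sets[OF refl pair] by simp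
  qed
  have pair_F: "(\<lambda>\<omega>. (T \<omega>, later \<omega>)) \<in> F \<rightarrow>\<^sub>M ?N"
    unfolding F_def using pair_space by (rule measurable_vimage_algebra1)
  have g_F: "?g \<in> borel_measurable F"
  proof -
    have "(\<lambda>z. exp (- rate * (e (fst z) - fst z)) * indicator S z :: real) \<in> borel_measurable ?N"
      by measurable
    from measurable_compose[OF pair_F this] show ?thesis
      by simp
  qed
  have g_bound: "0 \<le> ?g \<omega> \<and> ?g \<omega> \<le> 1" for \<omega>
    using e_bounds[of "T \<omega>"] rate_pos by (simp add: indicator_def)
  have "AE \<omega> in M. real_cond_exp M F (indicator E) \<omega> = ?g \<omega>"
  proof (rule F.real_cond_exp_charact)
    show "integrable M (indicator E :: 'a \<Rightarrow> real)"
      using E by (simp add: integrable_indicator_iff emeasure_eq_measure)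
    show "integrable M ?g"
      by (rule integrable_const_bound[where B = 1]) (use g_bound in auto)
    show "?g \<in> borel_measurable F"
      by (rule g_F)
    fix A assume "A \<in> sets F"
    then obtain B where B[measurable]: "B \<in> sets ?N" and A: "A = (\<lambda>\<omega>. (T \<omega>, later \<omega>)) -` B \<inter> space M"
      unfolding F_def sets_vimage_algebra2[OF pair_space] by auto
    have [measurable]: "A \<in> sets M"
      unfolding A by measurable
    have "(\<integral>\<omega>\<in>A. indicator E \<omega> \<partial>M) = enn2real (\<integral>\<^sup>+\<omega>. ennreal (indicator A \<omega> * indicator E \<omega>) \<partial>M)"
      unfolding set_lebesgue_integral_def by (simp add: integral_eq_nn_integral)
    also have "(\<integral>\<^sup>+\<omega>. ennreal (indicator A \<omega> * indicator E \<omega>) \<partial>M)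
        = (\<integral>\<^sup>+\<omega>. ennreal (of_bool (card (\<Phi> \<omega> \<inter> {T \<omega><..e (T \<omega>)}) = 0)) * indicator (B \<inter> S) (T \<omega>, later \<omega>) \<partial>M)"
      by (rule nn_integral_cong) (auto simp: indicator_def A no_edge)
    also have "\<dots> = (\<integral>\<^sup>+\<omega>. ennreal (exp (- rate * (e (T \<omega>) - T \<omega>))) * indicator (B \<inter> S) (T \<omega>, later \<omega>) \<partial>M)"
      using e_mono e_cont e_bounds by (intro void_given_later) auto
    also have "\<dots> = (\<integral>\<^sup>+\<omega>. ennreal (indicator A \<omega> * ?g \<omega>) \<partial>M)"
      by (rule nn_integral_cong) (auto simp: indicator_def A)
    also have "enn2real \<dots> = (\<integral>\<omega>\<in>A. ?g \<omega> \<partial>M)"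
      unfolding set_lebesgue_integral_def by (simp add: integral_eq_nn_integral)
    finally show "(\<integral>\<omega>\<in>A. indicator E \<omega> \<partial>M) = (\<integral>\<omega>\<in>A. ?g \<omega> \<partial>M)" .
  qed
  moreover have "AE \<omega> in M. ?g \<omega> = exp (- rate * min (max (w - T \<omega>) 0) 1) *
           indicator {\<omega> \<in> space M. gilbert (later \<omega> \<inter> {1..w - T \<omega>}) = {}} \<omega>"
  proof (rule AE_I2)
    fix \<omega> assume \<omega>: "\<omega> \<in> space M"
    have "e (T \<omega>) - T \<omega> = min (max (w - T \<omega>) 0) 1"
      by (auto simp: e_def)
    then show "?g \<omega> = exp (- rate * min (max (w - T \<omega>) 0) 1) *
           indicator {\<omega> \<in> space M. gilbert (later \<omega> \<inter> {1..w - T \<omega>}) = {}} \<omega>"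
      using \<omega> pair_space by (auto simp: indicator_def S_def)
  qed
  ultimately show ?thesis
    by eventually_elim simp
qed

end

theorem theorem1:
  fixes M :: "'a measure" and X :: "nat \<Rightarrow> 'a \<Rightarrow> real" and rate w :: real
  defines "\<Phi> \<equiv> \<lambda>\<omega>. {X i \<omega> | i. 1 \<le> i}"
  defines "E0 \<equiv> {\<omega> \<in> space M. card (gilbert (\<Phi> \<omega> \<inter> {0..w})) = 0}"
  defines "\<Phi>1 \<equiv> \<lambda>\<omega>. {x - X 1 \<omega> | x. x \<in> \<Phi> \<omega>} \<inter> {1..}"
  defines "F1 \<equiv> vimage_algebra (space M) (\<lambda>\<omega>. (X 1 \<omega>, \<Phi>1 \<omega>)) (borel \<Otimes>\<^sub>M config_space)"
  assumes "prob_space M"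
    and "0 < rate"
    and "homogeneous_poisson_process M rate {0..} \<Phi>"
    and "\<And>\<omega> i j. \<omega> \<in> space M \<Longrightarrow> 1 \<le> i \<Longrightarrow> i \<le> j \<Longrightarrow> X i \<omega> \<le> X j \<omega>"
    and "1 \<le> w"
  shows "AE \<omega> in M. real_cond_exp M F1 (indicator E0) \<omega> =
           exp (- rate * min (max (w - X 1 \<omega>) 0) 1) *
           indicator {\<omega> \<in> space M. gilbert (\<Phi>1 \<omega> \<inter> {1..w - X 1 \<omega>}) = {}} \<omega>"
proof -
  interpret prob_space M
    by fact
  interpret first_poisson_point M rate \<Phi> "X 1"
  proof
    show "homogeneous_poisson_process M rate {0..} \<Phi>" "0 < rate"
      by fact+
    fix \<omega> x assume \<omega>: "\<omega> \<in> space M"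
    show "X 1 \<omega> \<in> \<Phi> \<omega>"
      by (auto simp: \<Phi>_def)
    assume "x \<in> \<Phi> \<omega>"
    then obtain i where "x = X i \<omega>" "1 \<le> i"
      by (auto simp: \<Phi>_def)
    with \<omega> show "X 1 \<omega> \<le> x"
      using assms(8)[of \<omega> 1 i] by simp
  qed
  have \<Phi>1: "\<Phi>1 = later"
    by (rule ext) (simp only: \<Phi>1_def later_def)
  have "card (gilbert (\<Phi> \<omega> \<inter> {0..w})) = 0 \<longleftrightarrow> gilbert (\<Phi> \<omega> \<inter> {0..w}) = {}" if "\<omega> \<in> space M" for \<omega>
    using finite_gilbert[OF locally_finite_set_Int_bounded[OF locally_finite_process[OF that]], of "{0..w}"]
    by simp
  then have "E0 = {\<omega> \<in> space M. gilbert (\<Phi> \<omega> \<inter> {0..w}) = {}}"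
    unfolding E0_def by blast
  then show ?thesis
    using cond_prob_no_edge[of w] unfolding F1_def \<Phi>1 by simp
qed

end
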